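(* Let $A$ be a finite nonempty set of agents and $\mathrm{AP}$ a set of atomic propositions. The functors $\kappa$ and $\sigma$ induce an equivalence of categories between the category of simplicial models over $A$ and $\mathrm{AP}$ and the category of proper partial epistemic models over $A$ and $\mathrm{AP}$; and likewise between the corresponding categories of pointed simplicial models and pointed proper partial epistemic models.
   Context: $\mathrm{AP}=\bigcup_{a\in A}\mathrm{AP}_a$ is a disjoint union; for $U\subseteq A$, $\mathrm{AP}_U=\bigcup_{a\in U}\mathrm{AP}_a$. A chromatic simplicial complex $\langle V,S,\chi\rangle$: $S$ a family of nonempty subsets of $V$ containing singletons, closed under nonempty subsets, $\chi:V\to A$ injective on each simplex; $\mathcal{F}(\mathcal{C})$ its facets. A simplicial model $\langle V,S,\chi,\ell\rangle$ adds $\ell:\mathcal{F}(\mathcal{C})\to\mathcal{P}(\mathrm{AP})$; a morphism $f:\mathcal{C}\to\mathcal{D}$ is a chromatic simplicial map (vertex map preserving simplexes and colours) such that for all $X\in\mathcal{F}(\mathcal{C})$, $Y\in\mathcal{F}(\mathcal{D})$ with $f(X)\subseteq Y$, $\ell'(Y)\cap\mathrm{AP}_{\chi(X)}=\ell(X)\cap\mathrm{AP}_{\chi(X)}$. Pointed: pairs $(\mathcal{C},X)$, $X$ a facet; morphisms $f:(\mathcal{C},X)\to(\mathcal{D},Y)$ also satisfy $f(X)\subseteq Y$. A partial epistemic frame $\langle W,\sim\rangle$ has each $\sim_a$ symmetric and transitive; $\mathrm{live}(w)=\{a\mid w\sim_a w\}$; proper means for all $w,w'$ there is $a$ with $w\sim_a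 w$ and ($w\neq w'\Rightarrow w\not\sim_a w'$); $\mathrm{sat}_U(w)=\{w'\mid w\sim_a w'\ \forall a\in U\}$. Frame morphisms $h:W\to\mathcal{P}(W')$: $u\sim_a v\Rightarrow u'\sim'_a v'$ for all $u'\in h(u),v'\in h(v)$, and each $h(u)=\mathrm{sat}_{\mathrm{live}(u)}(u')$ for some $u'\in h(u)$; composition $(g\circ f)(u)=\mathrm{sat}_{\mathrm{live}(u)}(w)$ for any $v\in f(u)$, $w\in g(v)$. A partial epistemic model $\langle W,\sim,L\rangle$ adds $L:W\to\mathcal{P}(\mathrm{AP})$; a morphism is a frame morphism $h$ with $L'(w')\cap\mathrm{AP}_{\mathrm{live}(w)}=L(w)\cap\mathrm{AP}_{\mathrm{live}(w)}$ for all $w$ and $w'\in h(w)$; it is proper if its frame is. Pointed: pairs $(M,w)$; morphisms $h:(M,w)\to(M',w')$ satisfy $w'\in h(w)$. Functors: $\kappa(\mathcal{C})$ has worlds $\mathcal{F}(\mathcal{C})$, $X\sim_a Y$ iff $a\in\chi(X\cap Y)$, $L(X)=\ell(X)$; $\kappa(f)(X)=\{Z\in\mathcal{F}(\mathcal{D})\mid f(X)\subseteq Z\}$; $\kappa(\mathcal{C},X)=(\kappa(\mathcal{C}),X)$. $\sigma(M)$ has vertices $v^w_a=(a,[w]_a)$ ($w\in W$, $a\in\mathrm{live}(w)$, $[w]_a$ the $\sim_a$-class), simplexes all nonempty subsets of $X_w=\{v^w_a\mid a\in\mathrm{live}(w)\}$, $\chi(v^w_a)=a$, $\ell(X_w)=L(w)$;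 $\sigma(f)(v^w_a)=v^{w'}_a$ for any $w'\in f(w)$; $\sigma(M,w)=(\sigma(M),X_w)$.
   Formalization: As defined, morphisms of (pointed) models are not closed under composition, so each category is taken to be the one generated by them (finite composites); κ and σ are also shown to preserve the original morphisms. Models are small relative to an arbitrary universe. *)

theory Defs
  imports "HOL-Library.FuncSet" "HOL-Library.Disjoint_Sets" "HOL-Library.Infinite_Typeclass"
begin

section \<open>Categories, functors, equivalences\<close>

text \<open>
  Categories are given by hom-sets, which need not be disjoint; hence identities, composites and
  the action of a functor on morphisms take the objects involved as arguments.
  \<open>Cmp C x y z g f\<close> is the composite of \<open>f : x \<rightarrow> y\<close> and \<open>g : y \<rightarrow> z\<close>.
\<close>

record ('o, 'm) cat =
  Ob :: "'o set"
  Hom :: "'o \<Rightarrow> 'o \<Rightarrow> 'm set"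
  Idn :: "'o \<Rightarrow> 'm"
  Cmp :: "'o \<Rightarrow> 'o \<Rightarrow> 'o \<Rightarrow> 'm \<Rightarrow> 'm \<Rightarrow> 'm"

record ('o, 'm, 'p, 'n) cfunctor =
  on_ob :: "'o \<Rightarrow> 'p"
  on_mor :: "'o \<Rightarrow> 'o \<Rightarrow> 'm \<Rightarrow> 'n"

definition category :: "('o, 'm) cat \<Rightarrow> bool" where
  "category C \<longleftrightarrow>
     (\<forall>x\<in>Ob C. Idn C x \<in> Hom C x x) \<and>
     (\<forall>x\<in>Ob C. \<forall>y\<in>Ob C. \<forall>z\<in>Ob C. \<forall>f\<in>Hom C x y. \<forall>g\<in>Hom C y z.
        Cmp C x y z g f \<in> Hom C x z) \<and>
     (\<forall>x\<in>Ob C. \<forall>y\<in>Ob C. \<forall>f\<in>Hom C x y.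
        Cmp C x x y f (Idn C x) = f \<and> Cmp C x y y (Idn C y) f = f) \<and>
     (\<forall>w\<in>Ob C. \<forall>x\<in>Ob C. \<forall>y\<in>Ob C. \<forall>z\<in>Ob C.
        \<forall>f\<in>Hom C w x. \<forall>g\<in>Hom C x y. \<forall>h\<in>Hom C y z.
          Cmp C w x z (Cmp C x y z h g) f = Cmp C w y z h (Cmp C w x y g f))"

definition maps_homs :: "('o, 'm) cat \<Rightarrow> ('p, 'n) cat \<Rightarrow> ('o, 'm, 'p, 'n) cfunctor \<Rightarrow> bool" where
  "maps_homs C D F \<longleftrightarrow>
     (\<forall>x\<in>Ob C. on_ob F x \<in> Ob D) \<and>
     (\<forall>x\<in>Ob C. \<forall>y\<in>Ob C. \<forall>f\<in>Hom C x y. on_mor F x y f \<in> Hom D (on_ob F x) (on_ob F y))"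

definition is_functor :: "('o, 'm) cat \<Rightarrow> ('p, 'n) cat \<Rightarrow> ('o, 'm, 'p, 'n) cfunctor \<Rightarrow> bool" where
  "is_functor C D F \<longleftrightarrow>
     maps_homs C D F \<and>
     (\<forall>x\<in>Ob C. on_mor F x x (Idn C x) = Idn D (on_ob F x)) \<and>
     (\<forall>x\<in>Ob C. \<forall>y\<in>Ob C. \<forall>z\<in>Ob C. \<forall>f\<in>Hom C x y. \<forall>g\<in>Hom C y z.
        on_mor F x z (Cmp C x y z g f) =
        Cmp D (on_ob F x) (on_ob F y) (on_ob F z) (on_mor F y z g) (on_mor F x y f))"

definition id_functor :: "('o, 'm, 'o, 'm) cfunctor" where
  "id_functor = \<lparr>on_ob = (\<lambda>x. x), on_mor = (\<lambda>x y f. f)\<rparr>"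

definition comp_functor ::
    "('p, 'n, 'q, 'l) cfunctor \<Rightarrow> ('o, 'm, 'p, 'n) cfunctor \<Rightarrow> ('o, 'm, 'q, 'l) cfunctor" where
  "comp_functor G F =
     \<lparr>on_ob = (\<lambda>x. on_ob G (on_ob F x)),
      on_mor = (\<lambda>x y f. on_mor G (on_ob F x) (on_ob F y) (on_mor F x y f))\<rparr>"

definition is_iso :: "('o, 'm) cat \<Rightarrow> 'o \<Rightarrow> 'o \<Rightarrow> 'm \<Rightarrow> bool" where
  "is_iso C x y f \<longleftrightarrow> f \<in> Hom C x y \<and>
     (\<exists>g\<in>Hom C y x. Cmp C x y x g f = Idn C x \<and> Cmp C y x y f g = Idn C y)"

definition natural_iso ::
    "('o, 'm) cat \<Rightarrow> ('p, 'n) cat \<Rightarrow> ('o, 'm, 'p, 'n) cfunctor \<Rightarrow> ('o, 'm, 'p, 'n) cfunctor \<Rightarrow>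
     ('o \<Rightarrow> 'n) \<Rightarrow> bool" where
  "natural_iso C D F G \<eta> \<longleftrightarrow>
     (\<forall>x\<in>Ob C. is_iso D (on_ob F x) (on_ob G x) (\<eta> x)) \<and>
     (\<forall>x\<in>Ob C. \<forall>y\<in>Ob C. \<forall>f\<in>Hom C x y.
        Cmp D (on_ob F x) (on_ob F y) (on_ob G y) (\<eta> y) (on_mor F x y f) =
        Cmp D (on_ob F x) (on_ob G x) (on_ob G y) (on_mor G x y f) (\<eta> x))"

definition equivalence_of_categories ::
    "('o, 'm) cat \<Rightarrow> ('p, 'n) cat \<Rightarrow> ('o, 'm, 'p, 'n) cfunctor \<Rightarrow> ('p, 'n, 'o, 'm) cfunctor \<Rightarrow> bool" where
  "equivalence_of_categories C D F G \<longleftrightarrow>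
     category C \<and> category D \<and> is_functor C D F \<and> is_functor D C G \<and>
     (\<exists>\<eta>. natural_iso C C id_functor (comp_functor G F) \<eta>) \<and>
     (\<exists>\<epsilon>. natural_iso D D (comp_functor F G) id_functor \<epsilon>)"

text \<open>
  Same objects, identities and composition; the morphisms are the finite composites of the given
  ones. If the given morphisms are closed under composition, then nothing changes between objects
  of \<open>C\<close>.
\<close>

inductive generated_hom :: "('o, 'm) cat \<Rightarrow> 'o \<Rightarrow> 'o \<Rightarrow> 'm \<Rightarrow> bool" for C :: "('o, 'm) cat" where
  gen: "x \<in> Ob C \<Longrightarrow> y \<in> Ob C \<Longrightarrow> f \<in> Hom C x y \<Longrightarrow> generated_hom C x y f"
| comp: "generated_hom C x y f \<Longrightarrow> generated_hom C y z g \<Longrightarrow>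
    generated_hom C x z (Cmp C x y z g f)"

definition generated_cat :: "('o, 'm) cat \<Rightarrow> ('o, 'm) cat" where
  "generated_cat C = C\<lparr>Hom := \<lambda>x y. {f. generated_hom C x y f}\<rparr>"


section \<open>A universe of sets\<close>

text \<open>
  The categories must contain, with a model, its images under \<open>\<kappa>\<close> and \<open>\<sigma>\<close>, whose worlds are sets
  of vertices and whose vertices are pairs of an agent and a set of worlds. So all vertices and
  worlds are taken from one type that contains urelements, pairs with an agent, and (codes of) all
  of its subsets of cardinality at most that of the infinite type \<open>'k\<close>; a model is small if its
  vertices or worlds form such a subset. As \<open>'b\<close> and \<open>'k\<close> are arbitrary, every model on any type
  is isomorphic to one in a suitable universe. Distinct elements of the type may have the same
  members, but \<open>vset\<close> chooses one code for each small set, and only these codes are used.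
\<close>

datatype ('a, 'b, 'k) univ =
  Ur 'b | Tag (tag_of: 'a) "('a, 'b, 'k) univ" | Coll "'k \<Rightarrow> ('a, 'b, 'k) univ option"

fun elts :: "('a, 'b, 'k) univ \<Rightarrow> ('a, 'b, 'k) univ set" where
  "elts (Coll g) = {x. Some x \<in> range g}"
| "elts (Ur b) = {}"
| "elts (Tag a x) = {}"

definition small :: "('a, 'b, 'k) univ set \<Rightarrow> bool" where
  "small X \<longleftrightarrow> (\<exists>g :: 'k \<Rightarrow> ('a, 'b, 'k) univ. X \<subseteq> range g)"

definition vset :: "('a, 'b, 'k) univ set \<Rightarrow> ('a, 'b, 'k) univ" where
  "vset X = (SOME c. elts c = X)"

lemma elts_vset:
  fixes X :: "('a, 'b, 'k) univ set"
  assumes "small X"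
  shows "elts (vset X) = X"
proof -
  obtain g :: "'k \<Rightarrow> ('a, 'b, 'k) univ" where g: "X \<subseteq> range g"
    using assms unfolding small_def by blast
  have "x \<in> elts (Coll (\<lambda>k. if g k \<in> X then Some (g k) else None)) \<longleftrightarrow> x \<in> X" for x
  proof
    assume "x \<in> X"
    then obtain k where "x = g k"
      using g by blast
    then have "Some x = (if g k \<in> X then Some (g k) else None)"
      using \<open>x \<in> X\<close> by simp
    then show "x \<in> elts (Coll (\<lambda>k. if g k \<in> X then Some (g k) else None))"
      unfolding elts.simps mem_Collect_eq by (rule range_eqI)
  qed (auto split: if_splits)
  then have "elts (Coll (\<lambda>k. if g k \<in> X then Some (g k) else None)) = X"
    by blast
  then show ?thesis
    unfolding vset_def by (rule someI)
qed


section \<open>Simplicial models\<close>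

definition AP_on :: "('a \<Rightarrow> 'p set) \<Rightarrow> 'a set \<Rightarrow> 'p set" where
  "AP_on AP U = (\<Union>a\<in>U. AP a)"

record ('a, 'p, 'v) smodel =
  verts :: "'v set"
  simps :: "'v set set"
  colour :: "'v \<Rightarrow> 'a"
  flabel :: "'v set \<Rightarrow> 'p set"

definition facets :: "('a, 'p, 'v) smodel \<Rightarrow> 'v set set" where
  "facets C = {X \<in> simps C. \<forall>Y\<in>simps C. X \<subseteq> Y \<longrightarrow> Y = X}"

definition chromatic_complex :: "'a set \<Rightarrow> ('a, 'p, 'v) smodel \<Rightarrow> bool" where
  "chromatic_complex A C \<longleftrightarrow>
     (\<forall>X\<in>simps C. X \<noteq> {} \<and> X \<subseteq> verts C) \<and>
     (\<forall>v\<in>verts C. {v} \<in> simps C) \<and>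
     (\<forall>X\<in>simps C. \<forall>Y. Y \<noteq> {} \<and> Y \<subseteq> X \<longrightarrow> Y \<in> simps C) \<and>
     colour C \<in> verts C \<rightarrow>\<^sub>E A \<and>
     (\<forall>X\<in>simps C. inj_on (colour C) X)"

definition simplicial_model :: "'a set \<Rightarrow> ('a \<Rightarrow> 'p set) \<Rightarrow> ('a, 'p, 'v) smodel \<Rightarrow> bool" where
  "simplicial_model A AP C \<longleftrightarrow>
     chromatic_complex A C \<and> flabel C \<in> facets C \<rightarrow>\<^sub>E Pow (AP_on AP A)"

definition chromatic_map :: "('a, 'p, 'v) smodel \<Rightarrow> ('a, 'p, 'u) smodel \<Rightarrow> ('v \<Rightarrow> 'u) \<Rightarrow> bool" where
  "chromatic_map C D f \<longleftrightarrow>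
     f \<in> verts C \<rightarrow>\<^sub>E verts D \<and>
     (\<forall>X\<in>simps C. f ` X \<in> simps D) \<and>
     (\<forall>v\<in>verts C. colour D (f v) = colour C v)"

definition simplicial_morphism ::
    "('a \<Rightarrow> 'p set) \<Rightarrow> ('a, 'p, 'v) smodel \<Rightarrow> ('a, 'p, 'u) smodel \<Rightarrow> ('v \<Rightarrow> 'u) \<Rightarrow> bool" where
  "simplicial_morphism AP C D f \<longleftrightarrow>
     chromatic_map C D f \<and>
     (\<forall>X\<in>facets C. \<forall>Y\<in>facets D. f ` X \<subseteq> Y \<longrightarrow>
        flabel D Y \<inter> AP_on AP (colour C ` X) = flabel C X \<inter> AP_on AP (colour C ` X))"


section \<open>Partial epistemic models\<close>

record ('a, 'p, 'w) emodel =
  worlds :: "'w set"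
  acc :: "'a \<Rightarrow> ('w \<times> 'w) set"
  wlabel :: "'w \<Rightarrow> 'p set"

definition live :: "('a, 'p, 'w) emodel \<Rightarrow> 'w \<Rightarrow> 'a set" where
  "live M w = {a. (w, w) \<in> acc M a}"

definition sat :: "('a, 'p, 'w) emodel \<Rightarrow> 'a set \<Rightarrow> 'w \<Rightarrow> 'w set" where
  "sat M U w = {w' \<in> worlds M. \<forall>a\<in>U. (w, w') \<in> acc M a}"

text \<open>The relations are total functions of the agent type; outside \<open>A\<close> they are set to be empty.\<close>

definition partial_epistemic_frame :: "'a set \<Rightarrow> ('a, 'p, 'w) emodel \<Rightarrow> bool" where
  "partial_epistemic_frame A M \<longleftrightarrow>
     (\<forall>a\<in>A. acc M a \<subseteq> worlds M \<times> worlds M \<and> sym (acc M a) \<and> trans (acc M a)) \<and>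
     (\<forall>a. a \<notin> A \<longrightarrow> acc M a = {})"

definition proper_frame :: "'a set \<Rightarrow> ('a, 'p, 'w) emodel \<Rightarrow> bool" where
  "proper_frame A M \<longleftrightarrow>
     (\<forall>w\<in>worlds M. \<forall>w'\<in>worlds M. \<exists>a\<in>A.
        (w, w) \<in> acc M a \<and> (w \<noteq> w' \<longrightarrow> (w, w') \<notin> acc M a))"

definition partial_epistemic_model :: "'a set \<Rightarrow> ('a \<Rightarrow> 'p set) \<Rightarrow> ('a, 'p, 'w) emodel \<Rightarrow> bool" where
  "partial_epistemic_model A AP M \<longleftrightarrow>
     partial_epistemic_frame A M \<and> wlabel M \<in> worlds M \<rightarrow>\<^sub>E Pow (AP_on AP A)"

definition frame_morphism ::
    "('a, 'p, 'w) emodel \<Rightarrow> ('a, 'p, 'x) emodel \<Rightarrow> ('w \<Rightarrow> 'x set) \<Rightarrow> bool" where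
  "frame_morphism M N h \<longleftrightarrow>
     h \<in> worlds M \<rightarrow>\<^sub>E Pow (worlds N) \<and>
     (\<forall>a u v. (u, v) \<in> acc M a \<longrightarrow> (\<forall>u'\<in>h u. \<forall>v'\<in>h v. (u', v') \<in> acc N a)) \<and>
     (\<forall>u\<in>worlds M. \<exists>u'\<in>h u. h u = sat N (live M u) u')"

definition epistemic_morphism ::
    "('a \<Rightarrow> 'p set) \<Rightarrow> ('a, 'p, 'w) emodel \<Rightarrow> ('a, 'p, 'x) emodel \<Rightarrow> ('w \<Rightarrow> 'x set) \<Rightarrow> bool" where
  "epistemic_morphism AP M N h \<longleftrightarrow>
     frame_morphism M N h \<and>
     (\<forall>w\<in>worlds M. \<forall>w'\<in>h w.
        wlabel N w' \<inter> AP_on AP (live M w) = wlabel M w \<inter> AP_on AP (live M w))"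

text \<open>
  Here and in the definition of \<open>\<sigma>\<close>, \<open>THE\<close> renders ``for any'': the value shared by all choices.
\<close>

definition frame_comp ::
    "('a, 'p, 'w) emodel \<Rightarrow> ('a, 'p, 'y) emodel \<Rightarrow> ('x \<Rightarrow> 'y set) \<Rightarrow> ('w \<Rightarrow> 'x set) \<Rightarrow> 'w \<Rightarrow> 'y set" where
  "frame_comp M K g f =
     (\<lambda>u\<in>worlds M. THE T. \<forall>v\<in>f u. \<forall>w\<in>g v. T = sat K (live M u) w)"

definition frame_id :: "('a, 'p, 'w) emodel \<Rightarrow> 'w \<Rightarrow> 'w set" where
  "frame_id M = (\<lambda>u\<in>worlds M. sat M (live M u) u)"


section \<open>The categories\<close>

text \<open>
  Labels constrain a morphism only on the agents of the source facet or world, and adjacent facets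
  or worlds may disagree on the atoms of a shared agent. So a composite of two morphisms need not
  satisfy the label condition: the source may have an agent \<open>a\<close> only, the second morphism may fix
  the image of a further agent \<open>b\<close>, and the composite forgets \<open>b\<close> and is also tested against
  other targets containing the image of \<open>a\<close>. The morphisms of the categories are therefore the
  composites of the morphisms of models.
\<close>

definition simplicial_models ::
    "'a set \<Rightarrow> ('a \<Rightarrow> 'p set) \<Rightarrow>
     (('a, 'p, ('a, 'b, 'k) univ) smodel, ('a, 'b, 'k) univ \<Rightarrow> ('a, 'b, 'k) univ) cat" where
  "simplicial_models A AP =
     \<lparr>Ob = {C. simplicial_model A AP C \<and> small (verts C)},
      Hom = (\<lambda>C D. {f. simplicial_morphism AP C D f}),
      Idn = (\<lambda>C. \<lambda>v\<in>verts C. v),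
      Cmp = (\<lambda>C D E g f. compose (verts C) g f)\<rparr>"

definition proper_epistemic_models ::
    "'a set \<Rightarrow> ('a \<Rightarrow> 'p set) \<Rightarrow>
     (('a, 'p, ('a, 'b, 'k) univ) emodel, ('a, 'b, 'k) univ \<Rightarrow> ('a, 'b, 'k) univ set) cat" where
  "proper_epistemic_models A AP =
     \<lparr>Ob = {M. partial_epistemic_model A AP M \<and> proper_frame A M \<and> small (worlds M)},
      Hom = (\<lambda>M N. {h. epistemic_morphism AP M N h}),
      Idn = frame_id,
      Cmp = (\<lambda>M N K g f. frame_comp M K g f)\<rparr>"

definition pointed_simplicial_models ::
    "'a set \<Rightarrow> ('a \<Rightarrow> 'p set) \<Rightarrow>
     (('a, 'p, ('a, 'b, 'k) univ) smodel \<times> ('a, 'b, 'k) univ set,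
      ('a, 'b, 'k) univ \<Rightarrow> ('a, 'b, 'k) univ) cat" where
  "pointed_simplicial_models A AP =
     \<lparr>Ob = {(C, X). C \<in> Ob (simplicial_models A AP) \<and> X \<in> facets C},
      Hom = (\<lambda>(C, X) (D, Y). {f \<in> Hom (simplicial_models A AP) C D. f ` X \<subseteq> Y}),
      Idn = (\<lambda>(C, X). Idn (simplicial_models A AP) C),
      Cmp = (\<lambda>(C, X) (D, Y) (E, Z). Cmp (simplicial_models A AP) C D E)\<rparr>"

definition pointed_proper_epistemic_models ::
    "'a set \<Rightarrow> ('a \<Rightarrow> 'p set) \<Rightarrow>
     (('a, 'p, ('a, 'b, 'k) univ) emodel \<times> ('a, 'b, 'k) univ,
      ('a, 'b, 'k) univ \<Rightarrow> ('a, 'b, 'k) univ set) cat" where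
  "pointed_proper_epistemic_models A AP =
     \<lparr>Ob = {(M, w). M \<in> Ob (proper_epistemic_models A AP) \<and> w \<in> worlds M},
      Hom = (\<lambda>(M, w) (N, w'). {h \<in> Hom (proper_epistemic_models A AP) M N. w' \<in> h w}),
      Idn = (\<lambda>(M, w). Idn (proper_epistemic_models A AP) M),
      Cmp = (\<lambda>(M, w) (N, w') (K, w''). Cmp (proper_epistemic_models A AP) M N K)\<rparr>"


section \<open>The functors\<close>

definition kappa_ob ::
    "('a, 'p, ('a, 'b, 'k) univ) smodel \<Rightarrow> ('a, 'p, ('a, 'b, 'k) univ) emodel" where
  "kappa_ob C =
     \<lparr>worlds = vset ` facets C,
      acc = (\<lambda>a. {(vset X, vset Y) | X Y.
               X \<in> facets C \<and> Y \<in> facets C \<and> a \<in> colour C ` (X \<inter> Y)}),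
      wlabel = (\<lambda>x\<in>vset ` facets C. flabel C (elts x))\<rparr>"

definition kappa_mor ::
    "('a, 'p, ('a, 'b, 'k) univ) smodel \<Rightarrow> ('a, 'p, ('a, 'b, 'k) univ) smodel \<Rightarrow>
     (('a, 'b, 'k) univ \<Rightarrow> ('a, 'b, 'k) univ) \<Rightarrow> ('a, 'b, 'k) univ \<Rightarrow> ('a, 'b, 'k) univ set" where
  "kappa_mor C D f = (\<lambda>x\<in>vset ` facets C. {vset Z | Z. Z \<in> facets D \<and> f ` elts x \<subseteq> Z})"

definition kappa ::
    "(('a, 'p, ('a, 'b, 'k) univ) smodel, ('a, 'b, 'k) univ \<Rightarrow> ('a, 'b, 'k) univ,
      ('a, 'p, ('a, 'b, 'k) univ) emodel, ('a, 'b, 'k) univ \<Rightarrow> ('a, 'b, 'k) univ set) cfunctor" where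
  "kappa = \<lparr>on_ob = kappa_ob, on_mor = kappa_mor\<rparr>"

definition pointed_kappa ::
    "(('a, 'p, ('a, 'b, 'k) univ) smodel \<times> ('a, 'b, 'k) univ set,
      ('a, 'b, 'k) univ \<Rightarrow> ('a, 'b, 'k) univ,
      ('a, 'p, ('a, 'b, 'k) univ) emodel \<times> ('a, 'b, 'k) univ,
      ('a, 'b, 'k) univ \<Rightarrow> ('a, 'b, 'k) univ set) cfunctor" where
  "pointed_kappa =
     \<lparr>on_ob = (\<lambda>(C, X). (kappa_ob C, vset X)),
      on_mor = (\<lambda>(C, X) (D, Y). kappa_mor C D)\<rparr>"

definition vertex ::
    "('a, 'p, ('a, 'b, 'k) univ) emodel \<Rightarrow> 'a \<Rightarrow> ('a, 'b, 'k) univ \<Rightarrow> ('a, 'b, 'k) univ" where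
  "vertex M a w = Tag a (vset {w'. (w, w') \<in> acc M a})"

definition world_facet ::
    "('a, 'p, ('a, 'b, 'k) univ) emodel \<Rightarrow> ('a, 'b, 'k) univ \<Rightarrow> ('a, 'b, 'k) univ set" where
  "world_facet M w = {vertex M a w | a. a \<in> live M w}"

definition sigma_ob ::
    "('a, 'p, ('a, 'b, 'k) univ) emodel \<Rightarrow> ('a, 'p, ('a, 'b, 'k) univ) smodel" where
  "sigma_ob M =
     \<lparr>verts = (\<Union>w\<in>worlds M. world_facet M w),
      simps = {X. X \<noteq> {} \<and> (\<exists>w\<in>worlds M. X \<subseteq> world_facet M w)},
      colour = (\<lambda>v\<in>(\<Union>w\<in>worlds M. world_facet M w). tag_of v),
      flabel = (\<lambda>X\<in>world_facet M ` worlds M.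
                  THE P. \<forall>w\<in>worlds M. X = world_facet M w \<longrightarrow> P = wlabel M w)\<rparr>"

definition sigma_mor ::
    "('a, 'p, ('a, 'b, 'k) univ) emodel \<Rightarrow> ('a, 'p, ('a, 'b, 'k) univ) emodel \<Rightarrow>
     (('a, 'b, 'k) univ \<Rightarrow> ('a, 'b, 'k) univ set) \<Rightarrow> ('a, 'b, 'k) univ \<Rightarrow> ('a, 'b, 'k) univ" where
  "sigma_mor M N f =
     (\<lambda>v\<in>(\<Union>w\<in>worlds M. world_facet M w).
        THE v'. \<forall>w\<in>worlds M. \<forall>a\<in>live M w. v = vertex M a w \<longrightarrow>
          (\<forall>w'\<in>f w. v' = vertex N a w'))"

definition sigma ::
    "(('a, 'p, ('a, 'b, 'k) univ) emodel, ('a, 'b, 'k) univ \<Rightarrow> ('a, 'b, 'k) univ set,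
      ('a, 'p, ('a, 'b, 'k) univ) smodel, ('a, 'b, 'k) univ \<Rightarrow> ('a, 'b, 'k) univ) cfunctor" where
  "sigma = \<lparr>on_ob = sigma_ob, on_mor = sigma_mor\<rparr>"

definition pointed_sigma ::
    "(('a, 'p, ('a, 'b, 'k) univ) emodel \<times> ('a, 'b, 'k) univ,
      ('a, 'b, 'k) univ \<Rightarrow> ('a, 'b, 'k) univ set,
      ('a, 'p, ('a, 'b, 'k) univ) smodel \<times> ('a, 'b, 'k) univ set,
      ('a, 'b, 'k) univ \<Rightarrow> ('a, 'b, 'k) univ) cfunctor" where
  "pointed_sigma =
     \<lparr>on_ob = (\<lambda>(M, w). (sigma_ob M, world_facet M w)),
      on_mor = (\<lambda>(M, w) (N, w'). sigma_mor M N)\<rparr>"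

end

(*
  Composites of morphisms need not be morphisms, so all laws are proved for the larger classes of
  chromatic maps and of frame morphisms, which are closed under composition; there kappa and sigma
  are functors. For f chromatic and f(X) inside a facet Z, the facets containing f(X) are exactly
  sat(Z) over the colours of X, because a facet has at most one vertex of each colour; for h a frame
  morphism, sigma(h) maps X_w into X_w' exactly if w' is in h(w). By properness X_w determines w, and
  a vertex is determined by its colour and the facets around it. So the unit
  v |-> (colour of v, facets containing v) and the counit X_w |-> w are bijections, natural with
  respect to all chromatic maps and frame morphisms, and they preserve the labels (and points) in
  both directions. Hence the equivalence restricts to the generated subcategories.
*)

theory Submission
  imports Defs
begin

text \<open>Labels matter in two places only: the functors must send generators to generators, and
  unit, counit and their inverses must be generators. The remaining conditions are equations between
  composites. A composite of generators is one chromatic map or one frame morphism, so each equation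
  is checked once for these, and the pointed case reuses it. On the epistemic side the equations
  concern set-valued maps. They become easy because the value of a frame morphism at a world is a
  saturation, determined by any one of its members. Two composites agree as soon as they share one
  endpoint at every world, so units, associativity and naturality amount to exhibiting an endpoint.
  The label condition compares a facet with every facet above its image. A map that sends facets
  onto facets meets just one such facet, which is how the unit and its inverse satisfy the
  condition. Since colours embed a simplex into the finite set \<open>A\<close>, every simplex lies
  in a maximal one, and facets are sets of bounded size. An infinite index type can enumerate such
  sets, so \<open>kappa\<close> stays inside the universe.\<close>

section \<open>Equivalences of generated categories\<close>

text \<open>\<open>C\<close> need not be closed under composition: identities must belong to
  \<open>C\<close>, while composites are only computed as in \<open>C'\<close>. For pointed models
  \<open>p\<close> is \<open>fst\<close>, otherwise it is the identity.\<close>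

definition lies_over :: "('o, 'm) cat \<Rightarrow> ('q, 'm) cat \<Rightarrow> ('o \<Rightarrow> 'q) \<Rightarrow> bool" where
  "lies_over C C' p \<longleftrightarrow>
     (\<forall>x\<in>Ob C. p x \<in> Ob C' \<and> Idn C x \<in> Hom C x x \<and> Idn C x = Idn C' (p x)) \<and>
     (\<forall>x\<in>Ob C. \<forall>y\<in>Ob C. Hom C x y \<subseteq> Hom C' (p x) (p y)) \<and>
     (\<forall>x\<in>Ob C. \<forall>y\<in>Ob C. \<forall>z\<in>Ob C. Cmp C x y z = Cmp C' (p x) (p y) (p z))"

text \<open>Forgetting points changes objects but not morphisms, so the two actions on morphisms can
  be equated outright.\<close>

definition functor_over ::
    "('o, 'm) cat \<Rightarrow> ('o \<Rightarrow> 'q) \<Rightarrow> ('r \<Rightarrow> 's) \<Rightarrow> ('o, 'm, 'r, 'n) cfunctor \<Rightarrow>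
     ('q, 'm, 's, 'n) cfunctor \<Rightarrow> bool" where
  "functor_over C p q F F' \<longleftrightarrow>
     (\<forall>x\<in>Ob C. q (on_ob F x) = on_ob F' (p x)) \<and>
     (\<forall>x\<in>Ob C. \<forall>y\<in>Ob C. on_mor F x y = on_mor F' (p x) (p y))"

lemma generated_cat_simps [simp]:
  "Ob (generated_cat C) = Ob C"
  "Hom (generated_cat C) x y = {f. generated_hom C x y f}"
  "Idn (generated_cat C) = Idn C"
  "Cmp (generated_cat C) = Cmp C"
  by (simp_all add: generated_cat_def)

lemma generated_hom_Ob:
  assumes "generated_hom C x y f"
  shows "x \<in> Ob C" "y \<in> Ob C"
  using assms by (induction) auto

text \<open>\<open>C'\<close> is closed under composition and absorbs the composites. The laws of
  \<open>C'\<close> thereby become available for every generated morphism.\<close>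

lemma generated_hom_lies_over:
  assumes "generated_hom C x y f" "lies_over C C' p" "category C'"
  shows "f \<in> Hom C' (p x) (p y)"
  using assms(1)
proof induction
  case (gen x y f)
  then show ?case
    using assms(2) unfolding lies_over_def by blast
next
  case (comp x y f z g)
  then have ob: "x \<in> Ob C" "y \<in> Ob C" "z \<in> Ob C"
    using generated_hom_Ob by metis+
  then have "p x \<in> Ob C'" "p y \<in> Ob C'" "p z \<in> Ob C'"
    using assms(2) unfolding lies_over_def by auto
  moreover have "Cmp C x y z g f = Cmp C' (p x) (p y) (p z) g f"
    using ob assms(2) unfolding lies_over_def by simp
  ultimately show ?case
    using comp.IH assms(3) unfolding category_def by simp
qed

lemma category_generated:
  assumes over: "lies_over C C' p" and cat: "category C'"
  shows "category (generated_cat C)"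
proof -
  have ob: "p x \<in> Ob C'" "Idn C x = Idn C' (p x)" "Idn C x \<in> Hom C x x" if "x \<in> Ob C" for x
    using over that unfolding lies_over_def by auto
  have cmp: "Cmp C x y z = Cmp C' (p x) (p y) (p z)" if "x \<in> Ob C" "y \<in> Ob C" "z \<in> Ob C" for x y z
    using over that unfolding lies_over_def by auto
  have hom: "f \<in> Hom C' (p x) (p y)" if "generated_hom C x y f" for x y f
    using generated_hom_lies_over[OF that over cat] .
  show ?thesis
    unfolding category_def generated_cat_simps mem_Collect_eq
  proof (intro conjI ballI)
    fix x
    assume "x \<in> Ob C"
    then show "generated_hom C x x (Idn C x)"
      using ob by (simp add: generated_hom.gen)
  next
    fix x y z f g
    assume "f \<in> {f. generated_hom C x y f}" "g \<in> {g. generated_hom C y z g}"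
    then show "generated_hom C x z (Cmp C x y z g f)"
      by (auto intro: generated_hom.comp)
  next
    fix x y f
    assume *: "x \<in> Ob C" "y \<in> Ob C" "f \<in> {f. generated_hom C x y f}"
    then show "Cmp C x x y f (Idn C x) = f" "Cmp C x y y (Idn C y) f = f"
      using cat hom[of x y f] ob(1)[OF *(1)] ob(1)[OF *(2)]
      unfolding category_def by (simp_all add: cmp ob(2))
  next
    fix w x y z f g h
    assume *: "w \<in> Ob C" "x \<in> Ob C" "y \<in> Ob C" "z \<in> Ob C"
      "f \<in> {f. generated_hom C w x f}" "g \<in> {f. generated_hom C x y f}" "h \<in> {f. generated_hom C y z f}"
    then show "Cmp C w x z (Cmp C x y z h g) f = Cmp C w y z h (Cmp C w x y g f)"
      using cat hom[of w x f] hom[of x y g] hom[of y z h] ob(1)[OF *(1)] ob(1)[OF *(2)]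
        ob(1)[OF *(3)] ob(1)[OF *(4)]
      unfolding category_def by (simp add: cmp)
  qed
qed

text \<open>\<open>F\<close> has to respect generators only, because the composition law comes from
  \<open>F'\<close> and carries this over to composites.\<close>

lemma functor_generated:
  assumes C: "lies_over C C' p" "category C'" and D: "lies_over D D' q"
    and F': "is_functor C' D' F'" and F: "functor_over C p q F F'" "maps_homs C D F"
  shows "is_functor (generated_cat C) (generated_cat D) F"
proof -
  have ob: "p x \<in> Ob C'" "Idn C x = Idn C' (p x)" "on_ob F x \<in> Ob D"
      "q (on_ob F x) = on_ob F' (p x)" if "x \<in> Ob C" for x
    using C(1) F that unfolding lies_over_def functor_over_def maps_homs_def by auto
  have idn: "on_mor F x x (Idn C x) = Idn D (on_ob F x)" if "x \<in> Ob C" for x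
    using that ob[OF that] C(1) D F F' unfolding lies_over_def functor_over_def is_functor_def by simp
  have cmp: "on_mor F x z (Cmp C x y z g f) =
      Cmp D (on_ob F x) (on_ob F y) (on_ob F z) (on_mor F y z g) (on_mor F x y f)"
    if fg: "generated_hom C x y f" "generated_hom C y z g" for x y z f g
  proof -
    have xyz: "x \<in> Ob C" "y \<in> Ob C" "z \<in> Ob C"
      using generated_hom_Ob fg by metis+
    have "Cmp C x y z = Cmp C' (p x) (p y) (p z)"
      using C(1) xyz unfolding lies_over_def by blast
    moreover have "Cmp D (on_ob F x) (on_ob F y) (on_ob F z) =
        Cmp D' (on_ob F' (p x)) (on_ob F' (p y)) (on_ob F' (p z))"
      using D ob xyz unfolding lies_over_def by simp
    moreover have "on_mor F x z = on_mor F' (p x) (p z)" "on_mor F y z = on_mor F' (p y) (p z)"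
      "on_mor F x y = on_mor F' (p x) (p y)"
      using F xyz unfolding functor_over_def by auto
    moreover have "f \<in> Hom C' (p x) (p y)" "g \<in> Hom C' (p y) (p z)"
      using fg generated_hom_lies_over C by metis+
    ultimately show ?thesis
      using F' ob(1)[OF xyz(1)] ob(1)[OF xyz(2)] ob(1)[OF xyz(3)] unfolding is_functor_def by simp
  qed
  \<comment> \<open>The induction depends on the composition law just shown: it turns the image of a
    composite into a composite of images.\<close>
  have "generated_hom D (on_ob F x) (on_ob F y) (on_mor F x y f)" if "generated_hom C x y f" for x y f
    using that
  proof induction
    case (gen x y f)
    then show ?case
      using F(2) unfolding maps_homs_def by (simp add: generated_hom.gen)
  next
    case (comp x y f z g)
    then show ?case
      by (simp add: cmp generated_hom.comp)
  qed
  then show ?thesis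
    unfolding is_functor_def maps_homs_def using ob idn cmp by simp
qed

text \<open>The two halves live in different places: components and their inverses are morphisms of
  \<open>D\<close> itself, while the naturality squares commute in \<open>D'\<close> for all
  morphisms of \<open>C'\<close>.\<close>

lemma natural_iso_generated:
  assumes C: "lies_over C C' p" "category C'" and D: "lies_over D D' q"
    and F: "functor_over C p q F F'" "maps_homs C D F"
    and G: "functor_over C p q G G'" "maps_homs C D G"
    and iso: "\<And>x. x \<in> Ob C \<Longrightarrow> is_iso D (on_ob F x) (on_ob G x) (\<eta> (p x))"
    and nat: "\<And>x y f. x \<in> Ob C' \<Longrightarrow> y \<in> Ob C' \<Longrightarrow> f \<in> Hom C' x y \<Longrightarrow>
        Cmp D' (on_ob F' x) (on_ob F' y) (on_ob G' y) (\<eta> y) (on_mor F' x y f) =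
        Cmp D' (on_ob F' x) (on_ob G' x) (on_ob G' y) (on_mor G' x y f) (\<eta> x)"
  shows "natural_iso (generated_cat C) (generated_cat D) F G (\<lambda>x. \<eta> (p x))"
  unfolding natural_iso_def generated_cat_simps
proof (intro conjI ballI)
  fix x
  assume x: "x \<in> Ob C"
  have FG: "on_ob F x \<in> Ob D" "on_ob G x \<in> Ob D"
    using x F G unfolding maps_homs_def by auto
  show "is_iso (generated_cat D) (on_ob F x) (on_ob G x) (\<eta> (p x))"
    using iso[OF x] FG unfolding is_iso_def by (auto intro: generated_hom.gen)
next
  fix x y f
  assume xy: "x \<in> Ob C" "y \<in> Ob C" and "f \<in> {f. generated_hom C x y f}"
  then have f: "f \<in> Hom C' (p x) (p y)"
    using generated_hom_lies_over[OF _ C] by simp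
  have FG: "on_ob F x \<in> Ob D" "on_ob G x \<in> Ob D" "on_ob F y \<in> Ob D" "on_ob G y \<in> Ob D"
    using xy F G unfolding maps_homs_def by auto
  have "q (on_ob F x) = on_ob F' (p x)" "q (on_ob F y) = on_ob F' (p y)"
    "q (on_ob G x) = on_ob G' (p x)" "q (on_ob G y) = on_ob G' (p y)"
    "on_mor F x y = on_mor F' (p x) (p y)" "on_mor G x y = on_mor G' (p x) (p y)"
    using xy F G unfolding functor_over_def by auto
  moreover have "p x \<in> Ob C'" "p y \<in> Ob C'"
    using xy C unfolding lies_over_def by auto
  ultimately show "Cmp D (on_ob F x) (on_ob F y) (on_ob G y) (\<eta> (p y)) (on_mor F x y f) =
      Cmp D (on_ob F x) (on_ob G x) (on_ob G y) (on_mor G x y f) (\<eta> (p x))"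
    using nat[OF _ _ f] D FG unfolding lies_over_def by simp
qed

lemma functor_over_id: "functor_over C p p id_functor id_functor"
  by (simp add: functor_over_def id_functor_def)

lemma maps_homs_id: "maps_homs C C id_functor"
  by (simp add: maps_homs_def id_functor_def)

lemma functor_over_comp:
  assumes "functor_over C p q F F'" "functor_over D q r G G'" "maps_homs C D F"
  shows "functor_over C p r (comp_functor G F) (comp_functor G' F')"
  using assms by (simp add: functor_over_def comp_functor_def maps_homs_def)

lemma maps_homs_comp:
  assumes "maps_homs C D F" "maps_homs D E G"
  shows "maps_homs C E (comp_functor G F)"
  using assms by (simp add: maps_homs_def comp_functor_def)

text \<open>
  The functor laws and naturality are checked in categories \<open>C'\<close>, \<open>D'\<close> with more morphisms, which
  are closed under composition; \<open>p\<close> and \<open>q\<close> forget structure on the objects (the points).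
\<close>

lemma equivalence_generated:
  assumes C: "lies_over C C' p" "category C'" and D: "lies_over D D' q" "category D'"
    and F: "is_functor C' D' F'" "functor_over C p q F F'" "maps_homs C D F"
    and G: "is_functor D' C' G'" "functor_over D q p G G'" "maps_homs D C G"
    and unit_iso: "\<And>x. x \<in> Ob C \<Longrightarrow> is_iso C x (on_ob G (on_ob F x)) (\<eta> (p x))"
    and unit_nat: "\<And>x y f. x \<in> Ob C' \<Longrightarrow> y \<in> Ob C' \<Longrightarrow> f \<in> Hom C' x y \<Longrightarrow>
        Cmp C' x y (on_ob G' (on_ob F' y)) (\<eta> y) f =
        Cmp C' x (on_ob G' (on_ob F' x)) (on_ob G' (on_ob F' y))
          (on_mor G' (on_ob F' x) (on_ob F' y) (on_mor F' x y f)) (\<eta> x)"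
    and counit_iso: "\<And>x. x \<in> Ob D \<Longrightarrow> is_iso D (on_ob F (on_ob G x)) x (\<epsilon> (q x))"
    and counit_nat: "\<And>x y f. x \<in> Ob D' \<Longrightarrow> y \<in> Ob D' \<Longrightarrow> f \<in> Hom D' x y \<Longrightarrow>
        Cmp D' (on_ob F' (on_ob G' x)) (on_ob F' (on_ob G' y)) y (\<epsilon> y)
          (on_mor F' (on_ob G' x) (on_ob G' y) (on_mor G' x y f)) =
        Cmp D' (on_ob F' (on_ob G' x)) x y f (\<epsilon> x)"
  shows "equivalence_of_categories (generated_cat C) (generated_cat D) F G"
proof -
  have unit: "natural_iso (generated_cat C) (generated_cat C) id_functor (comp_functor G F) (\<lambda>x. \<eta> (p x))"
    by (rule natural_iso_generated[OF C C(1) functor_over_id maps_homs_id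
          functor_over_comp[OF F(2) G(2) F(3)] maps_homs_comp[OF F(3) G(3)]])
      (simp_all add: id_functor_def comp_functor_def unit_iso unit_nat)
  have counit: "natural_iso (generated_cat D) (generated_cat D) (comp_functor F G) id_functor
      (\<lambda>x. \<epsilon> (q x))"
    by (rule natural_iso_generated[OF D D(1) functor_over_comp[OF G(2) F(2) G(3)]
          maps_homs_comp[OF G(3) F(3)] functor_over_id maps_homs_id])
      (simp_all add: id_functor_def comp_functor_def counit_iso counit_nat)
  show ?thesis
    unfolding equivalence_of_categories_def
    by (intro conjI exI[of _ "\<lambda>x. \<eta> (p x)"] exI[of _ "\<lambda>x. \<epsilon> (q x)"] unit counit
        category_generated[OF C] category_generated[OF D]
        functor_generated[OF C D(1) F] functor_generated[OF D C(1) G])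
qed

section \<open>Smallness\<close>

lemma small_subset: "small Y \<Longrightarrow> X \<subseteq> Y \<Longrightarrow> small X"
  unfolding small_def by (elim exE) (rule exI, erule (1) order_trans)

lemma small_image:
  fixes X :: "('a, 'b, 'k) univ set" and f :: "_ \<Rightarrow> ('a, 'b, 'k) univ"
  shows "small X \<Longrightarrow> small (f ` X)"
proof -
  assume "small X"
  then obtain g :: "'k \<Rightarrow> ('a, 'b, 'k) univ" where "X \<subseteq> range g"
    unfolding small_def by blast
  then have "f ` X \<subseteq> range (\<lambda>k. f (g k))"
    by blast
  then show ?thesis
    unfolding small_def by blast
qed

text \<open>An infinite type is equinumerous with its square. A surjection is the form that suits
  \<open>small\<close>, which asks for an enumeration, possibly with repetitions.\<close>

lemma infinite_pairing_surj: "\<exists>p :: 'k::infinite \<Rightarrow> 'k \<times> 'k. surj p"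
proof -
  obtain f where "bij_betw f ((UNIV :: 'k set) \<times> (UNIV :: 'k set)) (UNIV :: 'k set)"
    using card_of_ordIso[THEN iffD2, OF card_of_Times_same_infinite[OF infinite_UNIV]] by blast
  then have "surj (inv f)"
    by (simp add: bij_betw_def inj_imp_surj_inv)
  then show ?thesis
    by blast
qed

lemma small_Un:
  fixes X Y :: "('a, 'b, 'k::infinite) univ set"
  assumes "small X" "small Y"
  shows "small (X \<union> Y)"
proof -
  obtain g h :: "'k \<Rightarrow> ('a, 'b, 'k) univ" where gh: "X \<subseteq> range g" "Y \<subseteq> range h"
    using assms unfolding small_def by blast
  obtain p :: "'k \<Rightarrow> 'k \<times> 'k" where p: "surj p"
    using infinite_pairing_surj by blast
  \<comment> \<open>Two distinct indices are wanted as selectors: first component \<open>c\<close>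
    selects \<open>g\<close>, any other selects \<open>h\<close>.\<close>
  have "\<exists>d :: 'k. d \<notin> {undefined}"
    by (rule ex_new_if_finite) (simp_all add: infinite_UNIV)
  then obtain c d :: 'k where cd: "c \<noteq> d"
    by blast
  let ?f = "\<lambda>k. if fst (p k) = c then g (snd (p k)) else h (snd (p k))"
  have "x \<in> range ?f" if "x \<in> X \<union> Y" for x
  proof -
    consider k where "x = g k" | k where "x = h k"
      using \<open>x \<in> X \<union> Y\<close> gh by blast
    then show ?thesis
    proof cases
      case (1 k)
      obtain l where "p l = (c, k)"
        using p by (metis surjD)
      then have "x = ?f l"
        using 1 by simp
      then show ?thesis
        by blast
    next
      case (2 k)
      obtain l where "p l = (d, k)"
        using p by (metis surjD)
      then have "x = ?f l"
        using 2 cd by simp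
      then show ?thesis
        by blast
    qed
  qed
  then show ?thesis
    unfolding small_def by blast
qed

lemma small_UN_finite:
  fixes X :: "'i \<Rightarrow> ('a, 'b, 'k::infinite) univ set"
  assumes "finite I" "\<And>i. i \<in> I \<Longrightarrow> small (X i)"
  shows "small (\<Union>i\<in>I. X i)"
  using assms
proof (induction I)
  case empty
  then show ?case
    by (simp add: small_def)
qed (simp add: small_Un)

text \<open>Induction on the size bound, with one use of the pairing per added element.
  \<open>small\<close> speaks of elements of the universe and not of sets of them, hence the image
  under \<open>f\<close>, which will be \<open>vset\<close>.\<close>

lemma small_image_bounded_subsets:
  fixes X :: "('a, 'b, 'k::infinite) univ set" and f :: "_ \<Rightarrow> ('a, 'b, 'k) univ"
  assumes "small X" "\<And>Y. Y \<in> \<X> \<Longrightarrow> Y \<subseteq> X \<and> Y \<noteq> {} \<and> finite Y \<and> card Y \<le> n"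
  shows "small (f ` \<X>)"
proof -
  obtain g :: "'k \<Rightarrow> ('a, 'b, 'k) univ" where g: "X \<subseteq> range g"
    using assms(1) unfolding small_def by blast
  obtain p :: "'k \<Rightarrow> 'k \<times> 'k" where p: "surj p"
    using infinite_pairing_surj by blast
  have "\<exists>G :: 'k \<Rightarrow> _. {Y. Y \<subseteq> X \<and> Y \<noteq> {} \<and> finite Y \<and> card Y \<le> Suc m} \<subseteq> range G" for m
  proof (induction m)
    case 0
    have "Y \<in> range (\<lambda>k. {g k})" if "Y \<subseteq> X \<and> Y \<noteq> {} \<and> finite Y \<and> card Y \<le> Suc 0" for Y
    proof -
      have "card Y = 1"
        using that by (metis One_nat_def card_0_eq le_Suc_eq le_zero_eq)
      then obtain y where "Y = {y}"
        by (rule card_1_singletonE)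
      then show ?thesis
        using that g by auto
    qed
    then show ?case
      by (intro exI[of _ "\<lambda>k. {g k}"] subsetI) simp
  next
    case (Suc m)
    obtain G :: "'k \<Rightarrow> _" where
      G: "{Y. Y \<subseteq> X \<and> Y \<noteq> {} \<and> finite Y \<and> card Y \<le> Suc m} \<subseteq> range G"
      using Suc.IH by (rule exE)
    \<comment> \<open>One index codes a single element together with the index of a set from the
      previous stage.\<close>
    have "Y \<in> range (\<lambda>k. insert (g (fst (p k))) (G (snd (p k))))"
      if Y: "Y \<subseteq> X" "Y \<noteq> {}" "finite Y" "card Y \<le> Suc (Suc m)" for Y
    proof -
      obtain y where y: "y \<in> Y"
        using Y by blast
      \<comment> \<open>Removing \<open>y\<close> from a singleton would leave the empty set, which
        is not enumerated; there \<open>Z\<close> is \<open>{y}\<close> again and inserting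
        \<open>y\<close> changes nothing.\<close>
      have "\<exists>Z. Y = insert y Z \<and> Z \<subseteq> X \<and> Z \<noteq> {} \<and> finite Z \<and> card Z \<le> Suc m"
      proof (cases "Y = {y}")
        case True
        then show ?thesis
          using Y y by (intro exI[of _ "{y}"]) simp
      next
        case False
        then show ?thesis
          using Y y by (intro exI[of _ "Y - {y}"]) auto
      qed
      then obtain Z where Z: "Y = insert y Z" "Z \<subseteq> X \<and> Z \<noteq> {} \<and> finite Z \<and> card Z \<le> Suc m"
        by (elim exE conjE) simp
      then have "Z \<in> range G"
        using subsetD[OF G] by simp
      then obtain l where l: "Z = G l"
        by (rule rangeE)
      have "y \<in> range g"
        using y Y(1) g by (meson subsetD)
      then obtain k where "y = g k"
        by (rule rangeE)
      moreover obtain j where "p j = (k, l)"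
        using p by (metis surjD)
      ultimately have "Y = insert (g (fst (p j))) (G (snd (p j)))"
        using Z(1) l by simp
      then show ?thesis
        by (rule range_eqI)
    qed
    then show ?case
      by (intro exI[of _ "\<lambda>k. insert (g (fst (p k))) (G (snd (p k)))"] subsetI) simp
  qed
  from this[of n] obtain G :: "'k \<Rightarrow> _" where
    "{Y. Y \<subseteq> X \<and> Y \<noteq> {} \<and> finite Y \<and> card Y \<le> Suc n} \<subseteq> range G"
    by (rule exE)
  moreover have "\<X> \<subseteq> {Y. Y \<subseteq> X \<and> Y \<noteq> {} \<and> finite Y \<and> card Y \<le> Suc n}"
    using assms(2) by (auto intro: le_SucI)
  ultimately have "\<X> \<subseteq> range G"
    by (rule subset_trans[rotated])
  then have "f ` \<X> \<subseteq> range (\<lambda>k. f (G k))"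
    by blast
  then show ?thesis
    unfolding small_def by blast
qed

lemma vset_inj: "small X \<Longrightarrow> small Y \<Longrightarrow> vset X = vset Y \<longleftrightarrow> X = Y"
  by (metis elts_vset)

section \<open>Frame morphisms\<close>

text \<open>Symmetry and transitivity allow a change of base point. The independence of choices in
  the composition of frame morphisms rests on this.\<close>

lemma sat_eq_sat:
  assumes "partial_epistemic_frame A M" "\<And>a. a \<in> U \<Longrightarrow> (w, w') \<in> acc M a"
  shows "sat M U w = sat M U w'"
proof -
  have "sym (acc M a) \<and> trans (acc M a)" for a
    using assms(1) unfolding partial_epistemic_frame_def by (cases "a \<in> A") auto
  then have "(w, x) \<in> acc M a \<longleftrightarrow> (w', x) \<in> acc M a" if "a \<in> U" for x a
    using assms(2)[OF that] by (meson symD transD)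
  then show ?thesis
    unfolding sat_def by auto
qed

lemma frame_sym: "partial_epistemic_frame A M \<Longrightarrow> (u, v) \<in> acc M a \<Longrightarrow> (v, u) \<in> acc M a"
  unfolding partial_epistemic_frame_def by (metis empty_iff symD)

lemma frame_trans:
  "partial_epistemic_frame A M \<Longrightarrow> (u, v) \<in> acc M a \<Longrightarrow> (v, w) \<in> acc M a \<Longrightarrow> (u, w) \<in> acc M a"
  unfolding partial_epistemic_frame_def by (metis empty_iff transD)

lemma frame_acc_worlds:
  assumes "partial_epistemic_frame A M" "(u, v) \<in> acc M a"
  shows "u \<in> worlds M" "v \<in> worlds M" "a \<in> A"
  using assms unfolding partial_epistemic_frame_def by (metis SigmaE2 empty_iff subsetD)+

lemma frame_acc_live:
  assumes "partial_epistemic_frame A M" "(u, v) \<in> acc M a"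
  shows "a \<in> live M u" "a \<in> live M v"
  unfolding live_def using assms frame_sym frame_trans by (metis mem_Collect_eq)+

lemma live_agents: "partial_epistemic_frame A M \<Longrightarrow> live M w \<subseteq> A"
  unfolding live_def using frame_acc_worlds(3) by fastforce

text \<open>The definition provides some generating member of \<open>h u\<close>. Any other member
  is related to it by all agents live at \<open>u\<close>, so it generates the same
  saturation.\<close>

lemma frame_morphism_eq_sat:
  assumes N: "partial_epistemic_frame A N" and h: "frame_morphism M N h"
    and "u \<in> worlds M" "u' \<in> h u"
  shows "h u = sat N (live M u) u'"
proof -
  obtain u'' where u'': "u'' \<in> h u" "h u = sat N (live M u) u''"
    using h assms(3) unfolding frame_morphism_def by blast
  then have "(u'', u') \<in> acc N a" if "a \<in> live M u" for a
    using that assms(4) unfolding sat_def by blast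
  then show ?thesis
    using sat_eq_sat[OF N] u'' by metis
qed

lemma frame_morphism_acc:
  "frame_morphism M N h \<Longrightarrow> (u, v) \<in> acc M a \<Longrightarrow> u' \<in> h u \<Longrightarrow> v' \<in> h v \<Longrightarrow> (u', v') \<in> acc N a"
  unfolding frame_morphism_def by blast

lemma frame_morphism_worlds:
  "frame_morphism M N h \<Longrightarrow> u \<in> worlds M \<Longrightarrow> u' \<in> h u \<Longrightarrow> u' \<in> worlds N"
  unfolding frame_morphism_def by blast

lemma frame_morphism_nonempty:
  assumes "frame_morphism M N h" "u \<in> worlds M"
  obtains u' where "u' \<in> h u"
  using assms unfolding frame_morphism_def by blast

lemma frame_morphism_live:
  assumes "frame_morphism M N h" "u' \<in> h u"
  shows "live M u \<subseteq> live N u'"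
  using assms frame_morphism_acc unfolding live_def by fastforce

text \<open>For an agent live at \<open>u\<close>, reflexivity at \<open>u\<close> relates any two
  choices in \<open>f u\<close>, and then any two endpoints reached through them. All candidates for
  the \<open>THE\<close> therefore coincide.\<close>

lemma frame_comp_eq_sat:
  assumes K: "partial_epistemic_frame A K" and f: "frame_morphism M N f" and g: "frame_morphism N K g"
    and u: "u \<in> worlds M" "v \<in> f u" "w \<in> g v"
  shows "frame_comp M K g f u = sat K (live M u) w"
proof -
  have eq: "sat K (live M u) w' = sat K (live M u) w" if v': "v' \<in> f u" "w' \<in> g v'" for v' w'
  proof (rule sat_eq_sat[OF K])
    fix a
    assume "a \<in> live M u"
    then have "(v', v) \<in> acc N a"
      using frame_morphism_acc[OF f] v' u unfolding live_def by blast
    then show "(w', w) \<in> acc K a"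
      using frame_morphism_acc[OF g] v' u by blast
  qed
  have "(THE T. \<forall>v\<in>f u. \<forall>w\<in>g v. T = sat K (live M u) w) = sat K (live M u) w"
  proof (rule the_equality)
    show "\<forall>v\<in>f u. \<forall>w'\<in>g v. sat K (live M u) w = sat K (live M u) w'"
      by (intro ballI eq[symmetric])
  qed (use u in blast)
  then show ?thesis
    using u(1) unfolding frame_comp_def by simp
qed

text \<open>Live sets only grow along frame morphisms, so the endpoint \<open>w\<close> is related
  to itself by every agent live at \<open>u\<close>.\<close>

lemma frame_comp_mem:
  assumes K: "partial_epistemic_frame A K" and f: "frame_morphism M N f" and g: "frame_morphism N K g"
    and u: "u \<in> worlds M" "v \<in> f u" "w \<in> g v"
  shows "w \<in> frame_comp M K g f u"
proof -
  have "w \<in> worlds K"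
    using f g u frame_morphism_worlds by metis
  moreover have "(w, w) \<in> acc K a" if "a \<in> live M u" for a
    using that u frame_morphism_live[OF f u(2)] frame_morphism_live[OF g u(3)] unfolding live_def by blast
  ultimately show ?thesis
    unfolding frame_comp_eq_sat[OF assms] sat_def by blast
qed

lemma frame_morphism_comp:
  assumes M: "partial_epistemic_frame A M" and K: "partial_epistemic_frame A K"
    and f: "frame_morphism M N f" and g: "frame_morphism N K g"
  shows "frame_morphism M K (frame_comp M K g f)"
proof -
  have ex: "\<exists>v w. v \<in> f u \<and> w \<in> g v" if "u \<in> worlds M" for u
    using that frame_morphism_nonempty f g frame_morphism_worlds by metis
  have "frame_comp M K g f \<in> worlds M \<rightarrow>\<^sub>E Pow (worlds K)"
  proof
    fix u
    assume u: "u \<in> worlds M"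
    then obtain v w where "v \<in> f u" "w \<in> g v"
      using ex by blast
    then show "frame_comp M K g f u \<in> Pow (worlds K)"
      unfolding frame_comp_eq_sat[OF K f g u \<open>v \<in> f u\<close> \<open>w \<in> g v\<close>] by (simp add: sat_def)
  qed (simp add: frame_comp_def)
  moreover have "(u', v') \<in> acc K a" if uv: "(u, v) \<in> acc M a"
    and "u' \<in> frame_comp M K g f u" "v' \<in> frame_comp M K g f v" for a u v u' v'
  proof -
    have u: "u \<in> worlds M" and v: "v \<in> worlds M"
      using frame_acc_worlds[OF M uv] by auto
    obtain u1 u2 where u12: "u1 \<in> f u" "u2 \<in> g u1"
      using ex[OF u] by blast
    obtain v1 v2 where v12: "v1 \<in> f v" "v2 \<in> g v1"
      using ex[OF v] by blast
    have "(u2, v2) \<in> acc K a"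
      using frame_morphism_acc[OF g frame_morphism_acc[OF f uv u12(1) v12(1)] u12(2) v12(2)] .
    \<comment> \<open>The agent \<open>a\<close> is live at both \<open>u\<close> and
      \<open>v\<close>, which links \<open>u'\<close> and \<open>v'\<close> to the related endpoints
      \<open>u2\<close> and \<open>v2\<close>.\<close>
    moreover have "u' \<in> sat K (live M u) u2" "v' \<in> sat K (live M v) v2"
      using that(2,3) unfolding frame_comp_eq_sat[OF K f g u u12] frame_comp_eq_sat[OF K f g v v12] .
    then have "(u2, u') \<in> acc K a" "(v2, v') \<in> acc K a"
      using frame_acc_live[OF M uv] unfolding sat_def by auto
    ultimately show ?thesis
      using frame_sym[OF K] frame_trans[OF K] by metis
  qed
  moreover have "\<exists>u'\<in>frame_comp M K g f u. frame_comp M K g f u = sat K (live M u) u'"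
    if u: "u \<in> worlds M" for u
  proof -
    obtain v w where vw: "v \<in> f u" "w \<in> g v"
      using ex[OF u] by blast
    show ?thesis
      using frame_comp_eq_sat[OF K f g u vw] frame_comp_mem[OF K f g u vw] by (rule bexI)
  qed
  ultimately show ?thesis
    unfolding frame_morphism_def by blast
qed

lemma frame_id_mem: "u \<in> worlds M \<Longrightarrow> u \<in> frame_id M u"
  by (simp add: frame_id_def sat_def live_def)

lemma frame_morphism_id:
  assumes M: "partial_epistemic_frame A M"
  shows "frame_morphism M M (frame_id M)"
proof -
  have "(u', v') \<in> acc M a" if uv: "(u, v) \<in> acc M a"
    and "u' \<in> frame_id M u" "v' \<in> frame_id M v" for a u v u' v'
  proof -
    have "(u, u') \<in> acc M a" "(v, v') \<in> acc M a"
      using that frame_acc_live[OF M uv] frame_acc_worlds[OF M uv]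
      by (auto simp: frame_id_def sat_def)
    then show ?thesis
      using uv frame_sym[OF M] frame_trans[OF M] by metis
  qed
  moreover have "frame_id M \<in> worlds M \<rightarrow>\<^sub>E Pow (worlds M)"
    by (auto simp: frame_id_def sat_def)
  moreover have "\<exists>u'\<in>frame_id M u. frame_id M u = sat M (live M u) u'" if "u \<in> worlds M" for u
    using frame_id_mem[OF that] that by (auto simp: frame_id_def)
  ultimately show ?thesis
    unfolding frame_morphism_def by blast
qed

text \<open>Both sides saturate over the same set \<open>live M u\<close>, so a shared endpoint
  makes them equal. The intermediate models may differ.\<close>

lemma frame_comp_cong_point:
  assumes "partial_epistemic_frame A K" "frame_morphism M N f" "frame_morphism N K g"
    and "frame_morphism M N' f'" "frame_morphism N' K g'"
    and "\<And>u. u \<in> worlds M \<Longrightarrow> \<exists>v v' w. v \<in> f u \<and> w \<in> g v \<and> v' \<in> f' u \<and> w \<in> g' v'"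
  shows "frame_comp M K g f = frame_comp M K g' f'"
proof
  fix u
  show "frame_comp M K g f u = frame_comp M K g' f' u"
  proof (cases "u \<in> worlds M")
    case True
    then show ?thesis
      using assms(6)[OF True] frame_comp_eq_sat[OF assms(1,2,3) True]
        frame_comp_eq_sat[OF assms(1,4,5) True] by metis
  qed (simp add: frame_comp_def)
qed

text \<open>The variant with a single morphism on the right: its value too is the saturation of any
  of its members.\<close>

lemma frame_comp_eqI:
  assumes K: "partial_epistemic_frame A K" and f: "frame_morphism M N f" and g: "frame_morphism N K g"
    and h: "frame_morphism M K h"
    and *: "\<And>u. u \<in> worlds M \<Longrightarrow> \<exists>v w. v \<in> f u \<and> w \<in> g v \<and> w \<in> h u"
  shows "frame_comp M K g f = h"
proof
  fix u
  show "frame_comp M K g f u = h u"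
  proof (cases "u \<in> worlds M")
    case True
    then show ?thesis
      using *[OF True] frame_comp_eq_sat[OF K f g True] frame_morphism_eq_sat[OF K h True] by metis
  next
    case False
    then show ?thesis
      using h by (auto simp: frame_comp_def frame_morphism_def PiE_def extensional_def)
  qed
qed

section \<open>The ambient categories of chromatic maps and of frame morphisms\<close>

definition chromatic_models ::
    "'a set \<Rightarrow> ('a \<Rightarrow> 'p set) \<Rightarrow>
     (('a, 'p, ('a, 'b, 'k) univ) smodel, ('a, 'b, 'k) univ \<Rightarrow> ('a, 'b, 'k) univ) cat" where
  "chromatic_models A AP = (simplicial_models A AP)\<lparr>Hom := \<lambda>C D. {f. chromatic_map C D f}\<rparr>"

definition proper_frames ::
    "'a set \<Rightarrow> ('a \<Rightarrow> 'p set) \<Rightarrow>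
     (('a, 'p, ('a, 'b, 'k) univ) emodel, ('a, 'b, 'k) univ \<Rightarrow> ('a, 'b, 'k) univ set) cat" where
  "proper_frames A AP = (proper_epistemic_models A AP)\<lparr>Hom := \<lambda>M N. {h. frame_morphism M N h}\<rparr>"

lemma chromatic_complexD:
  assumes "chromatic_complex A C"
  shows "X \<in> simps C \<Longrightarrow> X \<noteq> {}" "X \<in> simps C \<Longrightarrow> X \<subseteq> verts C"
    and "v \<in> verts C \<Longrightarrow> {v} \<in> simps C"
    and "X \<in> simps C \<Longrightarrow> Y \<noteq> {} \<Longrightarrow> Y \<subseteq> X \<Longrightarrow> Y \<in> simps C"
    and "colour C \<in> verts C \<rightarrow>\<^sub>E A" "X \<in> simps C \<Longrightarrow> inj_on (colour C) X"
proof -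
  note * = assms[unfolded chromatic_complex_def]
  show "X \<in> simps C \<Longrightarrow> X \<noteq> {}" "X \<in> simps C \<Longrightarrow> X \<subseteq> verts C"
    using *[THEN conjunct1] by blast+
  show "v \<in> verts C \<Longrightarrow> {v} \<in> simps C"
    using *[THEN conjunct2, THEN conjunct1] by blast
  show "X \<in> simps C \<Longrightarrow> Y \<noteq> {} \<Longrightarrow> Y \<subseteq> X \<Longrightarrow> Y \<in> simps C"
    using *[THEN conjunct2, THEN conjunct2, THEN conjunct1] by blast
  show "colour C \<in> verts C \<rightarrow>\<^sub>E A" "X \<in> simps C \<Longrightarrow> inj_on (colour C) X"
    using *[THEN conjunct2, THEN conjunct2, THEN conjunct2] by blast+
qed

text \<open>The colouring embeds a simplex into \<open>A\<close>. The bound \<open>card A\<close>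
  later yields maximal simplexes as well as the smallness of the set of facets.\<close>

lemma simplex_finite:
  assumes "chromatic_complex A C" "X \<in> simps C" "finite A"
  shows "finite X" "card X \<le> card A"
proof -
  have *: "inj_on (colour C) X" "colour C ` X \<subseteq> A"
    using chromatic_complexD(2,5,6)[OF assms(1)] assms(2) by (auto simp: PiE_iff)
  show "finite X"
    using inj_on_finite[OF * assms(3)] .
  show "card X \<le> card A"
    using card_inj_on_le[OF * assms(3)] .
qed

lemma chromatic_map_mem: "chromatic_map C D f \<Longrightarrow> v \<in> verts C \<Longrightarrow> f v \<in> verts D"
  unfolding chromatic_map_def by auto

lemma chromatic_map_id: "chromatic_complex A C \<Longrightarrow> chromatic_map C C (\<lambda>v\<in>verts C. v)"
proof -
  assume C: "chromatic_complex A C"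
  have "(\<lambda>v\<in>verts C. v) ` X = X" if "X \<in> simps C" for X
    using chromatic_complexD(2)[OF C that] by (auto simp: image_iff)
  then show ?thesis
    unfolding chromatic_map_def by auto
qed

lemma chromatic_map_comp:
  assumes C: "chromatic_complex A C" and f: "chromatic_map C D f" and g: "chromatic_map D E g"
  shows "chromatic_map C E (compose (verts C) g f)"
proof -
  have "compose (verts C) g f ` X = g ` f ` X" if "X \<in> simps C" for X
    using chromatic_complexD(2)[OF C that] unfolding image_image
    by (intro image_cong) (auto simp: compose_def)
  then have "\<forall>X\<in>simps C. compose (verts C) g f ` X \<in> simps E"
    using f g unfolding chromatic_map_def by simp
  moreover have "\<forall>v\<in>verts C. colour E (compose (verts C) g f v) = colour C v"
    using f g chromatic_map_mem[OF f] unfolding chromatic_map_def compose_def by simp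
  moreover have "compose (verts C) g f \<in> verts C \<rightarrow>\<^sub>E verts E"
    using chromatic_map_mem[OF f] chromatic_map_mem[OF g] by (simp add: compose_def)
  ultimately show ?thesis
    unfolding chromatic_map_def by blast
qed

lemma category_chromatic_models:
  fixes A :: "'a set" and AP :: "'a \<Rightarrow> 'p set"
  shows "category (chromatic_models A AP
    :: (('a, 'p, ('a, 'b, 'k) univ) smodel, ('a, 'b, 'k) univ \<Rightarrow> ('a, 'b, 'k) univ) cat)"
proof -
  have c: "chromatic_complex A C" if "simplicial_model A AP C" for C :: "('a, 'p, 'v) smodel"
    using that unfolding simplicial_model_def by blast
  have "compose (verts C) f (\<lambda>v\<in>verts C. v) = f" "compose (verts C) (\<lambda>v\<in>verts D. v) f = f"
    if f: "chromatic_map C D f" for C D :: "('a, 'p, ('a, 'b, 'k) univ) smodel" and f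
  proof -
    have "f \<in> verts C \<rightarrow>\<^sub>E verts D"
      using f unfolding chromatic_map_def by blast
    then show "compose (verts C) f (\<lambda>v\<in>verts C. v) = f" "compose (verts C) (\<lambda>v\<in>verts D. v) f = f"
      by (auto simp: fun_eq_iff compose_def restrict_def PiE_iff extensional_def)
  qed
  moreover have "compose (verts B) (compose (verts C) h g) f = compose (verts B) h (compose (verts B) g f)"
    if f: "chromatic_map B C f" for B C :: "('a, 'p, ('a, 'b, 'k) univ) smodel" and f
      and g h :: "('a, 'b, 'k) univ \<Rightarrow> ('a, 'b, 'k) univ"
    using chromatic_map_mem[OF f] by (auto simp: fun_eq_iff compose_def)
  ultimately show ?thesis
    unfolding category_def
    by (simp add: chromatic_models_def simplicial_models_def chromatic_map_id[OF c]
        chromatic_map_comp[OF c])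
qed

text \<open>For associativity, follow one chain from \<open>u\<close> through \<open>f\<close>,
  \<open>g\<close> and \<open>h\<close>; its endpoint belongs to both bracketings.\<close>

lemma category_proper_frames:
  fixes A :: "'a set" and AP :: "'a \<Rightarrow> 'p set"
  shows "category (proper_frames A AP
    :: (('a, 'p, ('a, 'b, 'k) univ) emodel, ('a, 'b, 'k) univ \<Rightarrow> ('a, 'b, 'k) univ set) cat)"
proof -
  have "frame_comp M M' f (frame_id M) = f \<and> frame_comp M M' (frame_id M') f = f"
    if M: "partial_epistemic_frame A M" "partial_epistemic_frame A M'" and f: "frame_morphism M M' f"
    for M M' :: "('a, 'p, ('a, 'b, 'k) univ) emodel" and f
    using frame_comp_eqI[OF M(2) frame_morphism_id[OF M(1)] f f]
      frame_comp_eqI[OF M(2) f frame_morphism_id[OF M(2)] f]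
      frame_id_mem frame_morphism_nonempty[OF f] frame_morphism_worlds[OF f] by metis
  moreover have "frame_comp L N (frame_comp M N h g) f = frame_comp L N h (frame_comp L M' g f)"
    if K: "partial_epistemic_frame A L" "partial_epistemic_frame A M" "partial_epistemic_frame A M'"
      "partial_epistemic_frame A N"
      and f: "frame_morphism L M f" and g: "frame_morphism M M' g" and h: "frame_morphism M' N h"
    for L M M' N :: "('a, 'p, ('a, 'b, 'k) univ) emodel" and f g h
  proof (rule frame_comp_cong_point[OF K(4) f frame_morphism_comp[OF K(2,4) g h]
        frame_morphism_comp[OF K(1,3) f g] h])
    fix u
    assume u: "u \<in> worlds L"
    obtain v where v: "v \<in> f u"
      using frame_morphism_nonempty[OF f u] by blast
    have v': "v \<in> worlds M"
      using frame_morphism_worlds[OF f u v] .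
    obtain w where w: "w \<in> g v"
      using frame_morphism_nonempty[OF g v'] by blast
    obtain x where x: "x \<in> h w"
      using frame_morphism_nonempty[OF h frame_morphism_worlds[OF g v' w]] by blast
    show "\<exists>v v' w. v \<in> f u \<and> w \<in> frame_comp M N h g v \<and> v' \<in> frame_comp L M' g f u \<and> w \<in> h v'"
      using v w x frame_comp_mem[OF K(3) f g u v w] frame_comp_mem[OF K(4) g h v' w x] by blast
  qed
  ultimately show ?thesis
    unfolding category_def
    by (simp add: proper_frames_def proper_epistemic_models_def partial_epistemic_model_def
        frame_morphism_id[of A] frame_morphism_comp[of A])
qed

section \<open>From simplicial models to epistemic models\<close>

locale smod =
  fixes A :: "'a set" and AP :: "'a \<Rightarrow> 'p set"
    and C :: "('a, 'p, ('a, 'b, 'k::infinite) univ) smodel"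
  assumes finite_agents: "finite A"
    and simplicial: "simplicial_model A AP C"
    and small_verts: "small (verts C)"
begin

lemma complex: "chromatic_complex A C"
  using simplicial unfolding simplicial_model_def by blast

lemmas complexD = chromatic_complexD[OF complex]

lemma facet_simplex: "X \<in> facets C \<Longrightarrow> X \<in> simps C"
  unfolding facets_def by blast

lemma facet_maximal: "X \<in> facets C \<Longrightarrow> Y \<in> simps C \<Longrightarrow> X \<subseteq> Y \<Longrightarrow> Y = X"
  unfolding facets_def by blast

lemma facet_verts: "X \<in> facets C \<Longrightarrow> v \<in> X \<Longrightarrow> v \<in> verts C"
  using complexD(2)[OF facet_simplex] by blast

text \<open>Among the simplexes containing \<open>X\<close> one of greatest cardinality exists
  because cardinalities are bounded by \<open>card A\<close>, and it is maximal for inclusion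
  because simplexes are finite.\<close>

lemma simplex_in_facet:
  assumes "X \<in> simps C"
  obtains Z where "Z \<in> facets C" "X \<subseteq> Z"
proof -
  let ?P = "\<lambda>Y. Y \<in> simps C \<and> X \<subseteq> Y"
  have "\<forall>Y. ?P Y \<longrightarrow> card Y \<le> card A"
    using simplex_finite(2)[OF complex _ finite_agents] by blast
  then have "\<exists>Z. ?P Z \<and> (\<forall>Y. ?P Y \<longrightarrow> card Y \<le> card Z)"
    using assms by (intro ex_has_greatest_nat[of _ X _ "Suc (card A)"]) (simp_all add: less_Suc_eq_le)
  then obtain Z where Z: "?P Z" and max: "\<And>Y. ?P Y \<Longrightarrow> card Y \<le> card Z"
    by blast
  have "Y = Z" if Y: "Y \<in> simps C" "Z \<subseteq> Y" for Y
  proof -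
    have "card Y \<le> card Z"
      using Y Z by (intro max) blast
    then show ?thesis
      using card_seteq[OF simplex_finite(1)[OF complex Y(1) finite_agents] Y(2)] by simp
  qed
  then show thesis
    using that[of Z] Z unfolding facets_def by simp
qed

lemma vertex_in_facet:
  assumes "v \<in> verts C"
  obtains X where "X \<in> facets C" "v \<in> X"
  using simplex_in_facet[OF complexD(3)[OF assms]] by blast

text \<open>A facet consists of vertices and is small, so its code loses nothing. This permits
  worlds of \<open>kappa_ob C\<close> to be treated as facets.\<close>

lemma elts_facet: "X \<in> facets C \<Longrightarrow> elts (vset X) = X"
  by (intro elts_vset small_subset[OF small_verts] complexD(2) facet_simplex)

lemma vset_facet_inj: "X \<in> facets C \<Longrightarrow> Y \<in> facets C \<Longrightarrow> vset X = vset Y \<longleftrightarrow> X = Y"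
  using elts_facet by metis

lemma facet_colour_inj:
  "X \<in> facets C \<Longrightarrow> v \<in> X \<Longrightarrow> v' \<in> X \<Longrightarrow> colour C v = colour C v' \<Longrightarrow> v = v'"
  using complexD(6)[OF facet_simplex] by (meson inj_onD)

lemma worlds_kappa: "worlds (kappa_ob C) = vset ` facets C"
  by (simp add: kappa_ob_def)

lemma acc_kappa:
  "X \<in> facets C \<Longrightarrow> Y \<in> facets C \<Longrightarrow>
    (vset X, vset Y) \<in> acc (kappa_ob C) a \<longleftrightarrow> a \<in> colour C ` (X \<inter> Y)"
  unfolding kappa_ob_def using vset_facet_inj by auto

lemma acc_kappaE:
  assumes "(x, y) \<in> acc (kappa_ob C) a"
  obtains X Y v where "X \<in> facets C" "Y \<in> facets C" "x = vset X" "y = vset Y"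
    "v \<in> X" "v \<in> Y" "a = colour C v"
  using assms unfolding kappa_ob_def by auto

lemma acc_kappaI:
  "X \<in> facets C \<Longrightarrow> Y \<in> facets C \<Longrightarrow> v \<in> X \<Longrightarrow> v \<in> Y \<Longrightarrow>
    (vset X, vset Y) \<in> acc (kappa_ob C) (colour C v)"
  using acc_kappa by blast

lemma live_kappa: "X \<in> facets C \<Longrightarrow> live (kappa_ob C) (vset X) = colour C ` X"
  unfolding live_def using acc_kappa by auto

lemma label_kappa: "X \<in> facets C \<Longrightarrow> wlabel (kappa_ob C) (vset X) = flabel C X"
  by (simp add: kappa_ob_def elts_facet)

text \<open>For transitivity, the vertex shared by the first two facets and the one shared by the
  last two have the same colour and both lie in the middle facet, so they are one vertex.\<close>

lemma frame_kappa: "partial_epistemic_frame A (kappa_ob C)"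
proof -
  have "acc (kappa_ob C) a \<subseteq> worlds (kappa_ob C) \<times> worlds (kappa_ob C)" for a
    unfolding worlds_kappa by (auto elim: acc_kappaE)
  moreover have "sym (acc (kappa_ob C) a)" for a
    by (rule symI) (auto elim!: acc_kappaE intro: acc_kappaI)
  moreover have "trans (acc (kappa_ob C) a)" for a
  proof (rule transI)
    fix x y z
    assume xy: "(x, y) \<in> acc (kappa_ob C) a" and yz: "(y, z) \<in> acc (kappa_ob C) a"
    obtain X Y v where 1: "X \<in> facets C" "Y \<in> facets C" "x = vset X" "y = vset Y"
      "v \<in> X" "v \<in> Y" "a = colour C v"
      using xy by (rule acc_kappaE)
    obtain Y' Z v' where 2: "Y' \<in> facets C" "Z \<in> facets C" "y = vset Y'" "z = vset Z"
      "v' \<in> Y'" "v' \<in> Z" "a = colour C v'"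
      using yz by (rule acc_kappaE)
    have "Y' = Y"
      using vset_facet_inj 1 2 by metis
    then have "v' = v"
      using facet_colour_inj 1 2 by metis
    then show "(x, z) \<in> acc (kappa_ob C) a"
      using 1 2 acc_kappaI by metis
  qed
  moreover have "acc (kappa_ob C) a = {}" if "a \<notin> A" for a
  proof -
    have "colour C v \<in> A" if "X \<in> facets C" "v \<in> X" for X v
      using complexD(5) facet_verts[OF that] by auto
    then show ?thesis
      using that acc_kappaE by (metis equals0I surj_pair)
  qed
  ultimately show ?thesis
    unfolding partial_epistemic_frame_def by blast
qed

text \<open>The witnessing agent is the colour of a vertex of \<open>X\<close> that lies outside
  \<open>Y\<close>. A vertex common to \<open>X\<close> and \<open>Y\<close> with that colour would
  have to be the chosen one.\<close>

lemma proper_kappa: "proper_frame A (kappa_ob C)"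
  unfolding proper_frame_def worlds_kappa
proof (intro ballI)
  fix x y
  assume "x \<in> vset ` facets C" "y \<in> vset ` facets C"
  then obtain X Y where XY: "x = vset X" "X \<in> facets C" "y = vset Y" "Y \<in> facets C"
    by blast
  \<comment> \<open>Facets are nonempty, and by maximality distinct facets are not nested.\<close>
  obtain v where v: "v \<in> X" "X \<noteq> Y \<Longrightarrow> v \<notin> Y"
    using XY complexD(1) facet_simplex facet_maximal by (metis all_not_in_conv subsetI)
  have "(x, x) \<in> acc (kappa_ob C) (colour C v)"
    using v XY acc_kappaI by blast
  moreover have "(x, y) \<notin> acc (kappa_ob C) (colour C v)" if "x \<noteq> y"
  proof
    assume "(x, y) \<in> acc (kappa_ob C) (colour C v)"
    then obtain v' where v': "v' \<in> X" "v' \<in> Y" "colour C v = colour C v'"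
      using acc_kappa XY by auto
    then have "v = v'"
      using facet_colour_inj XY v by blast
    then show False
      using v v' that XY by blast
  qed
  moreover have "colour C v \<in> A"
    using complexD(5) facet_verts v XY by auto
  ultimately show "\<exists>a\<in>A. (x, x) \<in> acc (kappa_ob C) a \<and> (x \<noteq> y \<longrightarrow> (x, y) \<notin> acc (kappa_ob C) a)"
    by blast
qed

lemma small_kappa: "small (worlds (kappa_ob C))"
  unfolding worlds_kappa
proof (rule small_image_bounded_subsets[OF small_verts])
  fix X
  assume "X \<in> facets C"
  then show "X \<subseteq> verts C \<and> X \<noteq> {} \<and> finite X \<and> card X \<le> card A"
    using complexD(1,2) simplex_finite[OF complex _ finite_agents] facet_simplex by blast
qed

lemma model_kappa: "partial_epistemic_model A AP (kappa_ob C)"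
proof -
  have "wlabel (kappa_ob C) \<in> worlds (kappa_ob C) \<rightarrow>\<^sub>E Pow (AP_on AP A)"
  proof
    fix x
    assume "x \<in> worlds (kappa_ob C)"
    then obtain X where "X \<in> facets C" "x = vset X"
      unfolding worlds_kappa by blast
    then show "wlabel (kappa_ob C) x \<in> Pow (AP_on AP A)"
      using simplicial label_kappa unfolding simplicial_model_def by (auto simp: PiE_iff)
  qed (simp add: kappa_ob_def)
  then show ?thesis
    unfolding partial_epistemic_model_def using frame_kappa by blast
qed

end

section \<open>The action of \<open>kappa\<close> on chromatic maps\<close>

locale chromatic = C: smod A AP C + D: smod A AP D
  for A :: "'a set" and AP :: "'a \<Rightarrow> 'p set" and C D :: "('a, 'p, ('a, 'b, 'k::infinite) univ) smodel" +
  fixes f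
  assumes chromatic_map: "chromatic_map C D f"
begin

lemma colour_map: "v \<in> verts C \<Longrightarrow> colour D (f v) = colour C v"
  using chromatic_map unfolding chromatic_map_def by blast

text \<open>The image of a facet is merely a simplex and may lie in several facets, which is why
  \<open>kappa_mor\<close> is set-valued.\<close>

lemma facet_image_in_facet:
  assumes "X \<in> facets C"
  obtains Z where "Z \<in> facets D" "f ` X \<subseteq> Z"
  using chromatic_map D.simplex_in_facet C.facet_simplex[OF assms] unfolding chromatic_map_def by metis

lemma kappa_mor_apply:
  "X \<in> facets C \<Longrightarrow> kappa_mor C D f (vset X) = vset ` {Z \<in> facets D. f ` X \<subseteq> Z}"
  by (auto simp: kappa_mor_def C.elts_facet)

lemma kappa_mor_mem:
  "X \<in> facets C \<Longrightarrow> Z \<in> facets D \<Longrightarrow> vset Z \<in> kappa_mor C D f (vset X) \<longleftrightarrow> f ` X \<subseteq> Z"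
  using kappa_mor_apply D.vset_facet_inj by auto

lemma kappa_mor_sat:
  assumes "X \<in> facets C" "Z \<in> facets D" "f ` X \<subseteq> Z"
  shows "kappa_mor C D f (vset X) = sat (kappa_ob D) (live (kappa_ob C) (vset X)) (vset Z)"
proof -
  have "f ` X \<subseteq> Z' \<longleftrightarrow> (\<forall>a\<in>colour C ` X. a \<in> colour D ` (Z \<inter> Z'))" if "Z' \<in> facets D" for Z'
  proof
    assume "f ` X \<subseteq> Z'"
    then have "colour C v \<in> colour D ` (Z \<inter> Z')" if "v \<in> X" for v
      using that assms(3) colour_map[OF C.facet_verts[OF assms(1) that]]
      by (intro image_eqI[of _ _ "f v"]) auto
    then show "\<forall>a\<in>colour C ` X. a \<in> colour D ` (Z \<inter> Z')"
      by blast
  next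
    assume *: "\<forall>a\<in>colour C ` X. a \<in> colour D ` (Z \<inter> Z')"
    show "f ` X \<subseteq> Z'"
    proof
      fix u
      assume "u \<in> f ` X"
      then obtain v where v: "v \<in> X" "u = f v"
        by blast
      then have "colour C v \<in> colour D ` (Z \<inter> Z')"
        using * by blast
      \<comment> \<open>The facet \<open>Z\<close> contains both \<open>f v\<close> and
        \<open>u'\<close>, which have the same colour, so \<open>f v\<close> is \<open>u'\<close>
        and lies in \<open>Z'\<close>.\<close>
      then obtain u' where "u' \<in> Z" "u' \<in> Z'" "colour D u' = colour C v"
        by auto
      moreover have "colour D u = colour C v" "u \<in> Z"
        using v assms colour_map C.facet_verts by auto
      ultimately show "u \<in> Z'"
        using D.facet_colour_inj assms(2) by metis
    qed
  qed
  then show ?thesis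
    unfolding kappa_mor_apply[OF assms(1)] sat_def C.live_kappa[OF assms(1)] D.worlds_kappa
    using D.acc_kappa[OF assms(2)] by auto
qed

text \<open>A vertex \<open>v\<close> common to \<open>X\<close> and \<open>Y\<close> is sent to
  \<open>f v\<close>, of the same colour and common to all facets above the two images.\<close>

lemma frame_morphism_kappa: "frame_morphism (kappa_ob C) (kappa_ob D) (kappa_mor C D f)"
proof -
  have "kappa_mor C D f \<in> worlds (kappa_ob C) \<rightarrow>\<^sub>E Pow (worlds (kappa_ob D))"
    unfolding C.worlds_kappa D.worlds_kappa
  proof (rule PiE_I)
    fix x
    assume "x \<notin> vset ` facets C"
    then show "kappa_mor C D f x = undefined"
      by (simp add: kappa_mor_def)
  qed (auto simp: kappa_mor_apply)
  moreover have "(x', y') \<in> acc (kappa_ob D) a" if xy: "(x, y) \<in> acc (kappa_ob C) a"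
    and x': "x' \<in> kappa_mor C D f x" and y': "y' \<in> kappa_mor C D f y" for a x y x' y'
  proof -
    obtain X Y v where 1: "X \<in> facets C" "Y \<in> facets C" "x = vset X" "y = vset Y"
      "v \<in> X" "v \<in> Y" "a = colour C v"
      using xy by (rule C.acc_kappaE)
    obtain X' Y' where 2: "x' = vset X'" "X' \<in> facets D" "f ` X \<subseteq> X'" "y' = vset Y'" "Y' \<in> facets D" "f ` Y \<subseteq> Y'"
      using x' y' 1 kappa_mor_apply by auto
    have "colour D (f v) = a" "f v \<in> X'" "f v \<in> Y'"
      using 1 2 colour_map C.facet_verts by auto
    then show ?thesis
      using 2 D.acc_kappaI by metis
  qed
  moreover have "\<exists>u'\<in>kappa_mor C D f u. kappa_mor C D f u = sat (kappa_ob D) (live (kappa_ob C) u) u'"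
    if u: "u \<in> worlds (kappa_ob C)" for u
  proof -
    obtain X where X: "X \<in> facets C" "u = vset X"
      using u unfolding C.worlds_kappa by blast
    obtain Z where Z: "Z \<in> facets D" "f ` X \<subseteq> Z"
      using facet_image_in_facet[OF X(1)] .
    show ?thesis
      using X Z kappa_mor_sat kappa_mor_mem by metis
  qed
  ultimately show ?thesis
    unfolding frame_morphism_def by blast
qed

lemma epistemic_morphism_kappa:
  assumes "simplicial_morphism AP C D f"
  shows "epistemic_morphism AP (kappa_ob C) (kappa_ob D) (kappa_mor C D f)"
proof -
  have "wlabel (kappa_ob D) x' \<inter> AP_on AP (live (kappa_ob C) x) =
      wlabel (kappa_ob C) x \<inter> AP_on AP (live (kappa_ob C) x)"
    if x: "x \<in> worlds (kappa_ob C)" and x': "x' \<in> kappa_mor C D f x" for x x'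
  proof -
    obtain X where X: "X \<in> facets C" "x = vset X"
      using x unfolding C.worlds_kappa by blast
    then obtain Z where Z: "Z \<in> facets D" "x' = vset Z" "f ` X \<subseteq> Z"
      using x' kappa_mor_apply by auto
    show ?thesis
      using assms X Z unfolding simplicial_morphism_def
      by (simp add: C.live_kappa C.label_kappa D.label_kappa)
  qed
  then show ?thesis
    unfolding epistemic_morphism_def using frame_morphism_kappa by blast
qed

end

lemma (in smod) kappa_mor_id: "kappa_mor C C (\<lambda>v\<in>verts C. v) = frame_id (kappa_ob C)"
proof
  interpret chromatic A AP C C "\<lambda>v\<in>verts C. v"
    by unfold_locales (rule chromatic_map_id[OF complex])
  fix x
  show "kappa_mor C C (\<lambda>v\<in>verts C. v) x = frame_id (kappa_ob C) x"
  proof (cases "x \<in> worlds (kappa_ob C)")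
    case True
    then obtain X where X: "X \<in> facets C" "x = vset X"
      unfolding worlds_kappa by blast
    then have "(\<lambda>v\<in>verts C. v) ` X \<subseteq> X"
      using facet_verts by auto
    then show ?thesis
      using X True kappa_mor_sat[OF X(1) X(1)] by (simp add: frame_id_def)
  qed (simp add: kappa_mor_def frame_id_def worlds_kappa)
qed

text \<open>Choose a facet \<open>Y\<close> above the image of \<open>X\<close> and a facet
  \<open>Z\<close> above the image of \<open>Y\<close>; then \<open>Z\<close> is an endpoint of both
  sides.\<close>

lemma kappa_mor_comp:
  assumes "chromatic A AP C D f" "chromatic A AP D E g"
  shows "kappa_mor C E (compose (verts C) g f) =
    frame_comp (kappa_ob C) (kappa_ob E) (kappa_mor D E g) (kappa_mor C D f)"
proof -
  interpret f: chromatic A AP C D f by fact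
  interpret g: chromatic A AP D E g by fact
  interpret gf: chromatic A AP C E "compose (verts C) g f"
    by unfold_locales (rule chromatic_map_comp[OF f.C.complex f.chromatic_map g.chromatic_map])
  have "\<exists>v w. v \<in> kappa_mor C D f x \<and> w \<in> kappa_mor D E g v \<and> w \<in> kappa_mor C E (compose (verts C) g f) x"
    if x: "x \<in> worlds (kappa_ob C)" for x
  proof -
    obtain X where X: "X \<in> facets C" "x = vset X"
      using x unfolding f.C.worlds_kappa by blast
    obtain Y where Y: "Y \<in> facets D" "f ` X \<subseteq> Y"
      using f.facet_image_in_facet[OF X(1)] .
    obtain Z where Z: "Z \<in> facets E" "g ` Y \<subseteq> Z"
      using g.facet_image_in_facet[OF Y(1)] .
    have "compose (verts C) g f ` X \<subseteq> Z"
      using Y Z f.C.facet_verts[OF X(1)] by (auto simp: compose_def)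
    then show ?thesis
      using X Y Z f.kappa_mor_mem g.kappa_mor_mem gf.kappa_mor_mem by metis
  qed
  then show ?thesis
    by (intro frame_comp_eqI[OF g.D.frame_kappa f.frame_morphism_kappa g.frame_morphism_kappa
          gf.frame_morphism_kappa, symmetric])
qed

section \<open>From epistemic models to simplicial models\<close>

locale emod =
  fixes A :: "'a set" and AP :: "'a \<Rightarrow> 'p set"
    and M :: "('a, 'p, ('a, 'b, 'k::infinite) univ) emodel"
  assumes finite_agents: "finite A"
    and model: "partial_epistemic_model A AP M"
    and proper: "proper_frame A M"
    and small_worlds: "small (worlds M)"
begin

lemma frame: "partial_epistemic_frame A M"
  using model unfolding partial_epistemic_model_def by blast

lemmas acc_sym = frame_sym[OF frame]
lemmas acc_trans = frame_trans[OF frame]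
lemmas acc_worlds = frame_acc_worlds[OF frame]
lemmas acc_live = frame_acc_live[OF frame]

lemma live_iff: "a \<in> live M w \<longleftrightarrow> (w, w) \<in> acc M a"
  by (simp add: live_def)

lemma class_small: "small {w'. (w, w') \<in> acc M a}"
  using small_worlds by (rule small_subset) (use acc_worlds in blast)

text \<open>Classes are small, so their codes are equal only if the classes are. Liveness puts
  \<open>w\<close> into its own class; otherwise both classes could be empty and say nothing about
  \<open>w\<close> and \<open>u\<close>.\<close>

lemma vertex_eq_iff:
  assumes "a \<in> live M w"
  shows "vertex M a w = vertex M b u \<longleftrightarrow> a = b \<and> (w, u) \<in> acc M a"
proof
  assume "vertex M a w = vertex M b u"
  then have "a = b" "vset {w'. (w, w') \<in> acc M a} = vset {w'. (u, w') \<in> acc M b}"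
    unfolding vertex_def by auto
  then have "a = b" "{w'. (w, w') \<in> acc M a} = {w'. (u, w') \<in> acc M b}"
    using vset_inj class_small by metis+
  then show "a = b \<and> (w, u) \<in> acc M a"
    using assms acc_sym unfolding live_iff by blast
next
  assume *: "a = b \<and> (w, u) \<in> acc M a"
  then have "(w, x) \<in> acc M a \<longleftrightarrow> (u, x) \<in> acc M b" for x
    using acc_sym acc_trans by blast
  then show "vertex M a w = vertex M b u"
    using * unfolding vertex_def by simp
qed

lemma vertex_in_world_facet:
  assumes "a \<in> live M w"
  shows "vertex M a w \<in> world_facet M u \<longleftrightarrow> (w, u) \<in> acc M a"
  unfolding world_facet_def using vertex_eq_iff[OF assms] acc_live(2) by auto

lemma vertex_mem: "a \<in> live M w \<Longrightarrow> vertex M a w \<in> world_facet M w"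
  unfolding world_facet_def by blast

lemma world_facetE:
  assumes "v \<in> world_facet M w"
  obtains a where "a \<in> live M w" "v = vertex M a w"
  using assms unfolding world_facet_def by blast

lemma properE:
  assumes "w \<in> worlds M" "u \<in> worlds M"
  obtains a where "a \<in> live M w" "w \<noteq> u \<Longrightarrow> (w, u) \<notin> acc M a"
  using proper assms unfolding proper_frame_def live_iff by meson

lemma world_facet_nonempty: "w \<in> worlds M \<Longrightarrow> world_facet M w \<noteq> {}"
  using properE vertex_mem by (metis empty_iff)

text \<open>Properness supplies an agent live at \<open>w\<close> that separates \<open>w\<close>
  from a different \<open>u\<close>; its vertex at \<open>w\<close> is missing around
  \<open>u\<close>. Both maximality and injectivity of \<open>world_facet\<close> follow.\<close>

lemma world_facet_subsetD:
  assumes "w \<in> worlds M" "u \<in> worlds M" "world_facet M w \<subseteq> world_facet M u"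
  shows "w = u"
  using properE[OF assms(1,2)] vertex_mem vertex_in_world_facet assms(3) by (metis subsetD)

lemma world_facet_inj: "w \<in> worlds M \<Longrightarrow> u \<in> worlds M \<Longrightarrow> world_facet M w = world_facet M u \<longleftrightarrow> w = u"
  using world_facet_subsetD by blast

lemma verts_sigma: "verts (sigma_ob M) = (\<Union>w\<in>worlds M. world_facet M w)"
  by (simp add: sigma_ob_def)

lemma simps_sigma: "X \<in> simps (sigma_ob M) \<longleftrightarrow> X \<noteq> {} \<and> (\<exists>w\<in>worlds M. X \<subseteq> world_facet M w)"
  by (simp add: sigma_ob_def)

lemma facets_sigma: "facets (sigma_ob M) = world_facet M ` worlds M"
proof (intro equalityI subsetI)
  fix X
  assume X: "X \<in> facets (sigma_ob M)"
  then obtain w where w: "w \<in> worlds M" "X \<subseteq> world_facet M w"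
    unfolding facets_def simps_sigma by blast
  then have "world_facet M w \<in> simps (sigma_ob M)"
    unfolding simps_sigma using world_facet_nonempty by blast
  then show "X \<in> world_facet M ` worlds M"
    using X w unfolding facets_def by blast
next
  fix X
  assume "X \<in> world_facet M ` worlds M"
  then obtain w where w: "w \<in> worlds M" "X = world_facet M w"
    by blast
  have "Y = X" if Y: "Y \<in> simps (sigma_ob M)" "X \<subseteq> Y" for Y
  proof -
    obtain u where u: "u \<in> worlds M" "Y \<subseteq> world_facet M u"
      using Y(1) unfolding simps_sigma by blast
    then have "w = u"
      using world_facet_subsetD w Y(2) by blast
    then show ?thesis
      using w u Y by blast
  qed
  moreover have "X \<in> simps (sigma_ob M)"
    unfolding simps_sigma using w world_facet_nonempty by blast
  ultimately show "X \<in> facets (sigma_ob M)"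
    unfolding facets_def by blast
qed

lemma colour_sigma: "w \<in> worlds M \<Longrightarrow> a \<in> live M w \<Longrightarrow> colour (sigma_ob M) (vertex M a w) = a"
  using vertex_mem by (auto simp: sigma_ob_def) (auto simp: vertex_def)

lemma colour_world_facet: "w \<in> worlds M \<Longrightarrow> colour (sigma_ob M) ` world_facet M w = live M w"
proof -
  assume w: "w \<in> worlds M"
  have "world_facet M w = (\<lambda>a. vertex M a w) ` live M w"
    unfolding world_facet_def by blast
  then show ?thesis
    using colour_sigma[OF w] by (simp add: image_image)
qed

lemma label_sigma:
  assumes "w \<in> worlds M"
  shows "flabel (sigma_ob M) (world_facet M w) = wlabel M w"
proof -
  have "(THE P. \<forall>u\<in>worlds M. world_facet M w = world_facet M u \<longrightarrow> P = wlabel M u) = wlabel M w"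
    by (rule the_equality) (use assms world_facet_inj[OF assms] in auto)
  then show ?thesis
    using assms by (simp add: sigma_ob_def)
qed

lemma complex_sigma: "chromatic_complex A (sigma_ob M)"
  unfolding chromatic_complex_def
proof (intro conjI ballI allI impI)
  fix X
  assume X: "X \<in> simps (sigma_ob M)"
  then show "X \<noteq> {}" "X \<subseteq> verts (sigma_ob M)"
    unfolding simps_sigma verts_sigma by blast+
  obtain w where w: "w \<in> worlds M" "X \<subseteq> world_facet M w"
    using X unfolding simps_sigma by blast
  have "inj_on (colour (sigma_ob M)) (world_facet M w)"
  proof (rule inj_onI)
    fix v v'
    assume v: "v \<in> world_facet M w" and v': "v' \<in> world_facet M w"
      and eq: "colour (sigma_ob M) v = colour (sigma_ob M) v'"
    obtain a where a: "a \<in> live M w" "v = vertex M a w"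
      using v by (rule world_facetE)
    obtain b where b: "b \<in> live M w" "v' = vertex M b w"
      using v' by (rule world_facetE)
    show "v = v'"
      using eq colour_sigma[OF w(1)] a b by simp
  qed
  then show "inj_on (colour (sigma_ob M)) X"
    using w(2) by (rule inj_on_subset)
  show "Y \<in> simps (sigma_ob M)" if "Y \<noteq> {} \<and> Y \<subseteq> X" for Y
    using that w unfolding simps_sigma by blast
next
  fix v
  assume "v \<in> verts (sigma_ob M)"
  then show "{v} \<in> simps (sigma_ob M)"
    unfolding simps_sigma verts_sigma by blast
next
  show "colour (sigma_ob M) \<in> verts (sigma_ob M) \<rightarrow>\<^sub>E A"
  proof (rule PiE_I)
    fix v
    assume "v \<in> verts (sigma_ob M)"
    then obtain w where "w \<in> worlds M" "v \<in> world_facet M w"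
      unfolding verts_sigma by blast
    then show "colour (sigma_ob M) v \<in> A"
      using colour_world_facet live_agents[OF frame] by blast
  qed (simp add: sigma_ob_def)
qed

text \<open>A vertex is given by an agent and any world representing its class, so finitely many
  images of the set of worlds cover all vertices.\<close>

lemma small_sigma: "small (verts (sigma_ob M))"
proof (rule small_subset)
  show "small (\<Union>a\<in>A. vertex M a ` worlds M)"
    using finite_agents small_image[OF small_worlds] by (rule small_UN_finite)
  show "verts (sigma_ob M) \<subseteq> (\<Union>a\<in>A. vertex M a ` worlds M)"
    unfolding verts_sigma world_facet_def using live_agents[OF frame] by blast
qed

lemma model_sigma: "simplicial_model A AP (sigma_ob M)"
proof -
  have "flabel (sigma_ob M) \<in> facets (sigma_ob M) \<rightarrow>\<^sub>E Pow (AP_on AP A)"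
    unfolding facets_sigma
  proof (rule PiE_I)
    fix X
    assume "X \<in> world_facet M ` worlds M"
    then obtain w where "w \<in> worlds M" "X = world_facet M w"
      by blast
    then show "flabel (sigma_ob M) X \<in> Pow (AP_on AP A)"
      using model label_sigma unfolding partial_epistemic_model_def by (auto simp: PiE_iff)
  qed (simp add: sigma_ob_def)
  then show ?thesis
    unfolding simplicial_model_def using complex_sigma by blast
qed

end

section \<open>The action of \<open>sigma\<close> on frame morphisms\<close>

locale frame_map = M: emod A AP M + N: emod A AP N
  for A :: "'a set" and AP :: "'a \<Rightarrow> 'p set" and M N :: "('a, 'p, ('a, 'b, 'k::infinite) univ) emodel" +
  fixes h
  assumes frame_morphism: "frame_morphism M N h"
begin

text \<open>Two representatives of one vertex are related by its agent, hence so are their images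
  under \<open>h\<close>, which then define the same vertex. This settles the
  \<open>THE\<close>.\<close>

lemma sigma_mor_vertex:
  assumes w: "w \<in> worlds M" "a \<in> live M w" "w' \<in> h w"
  shows "sigma_mor M N h (vertex M a w) = vertex N a w'"
proof -
  have eq: "vertex N a w' = vertex N b u'"
    if u: "u \<in> worlds M" "b \<in> live M u" "vertex M a w = vertex M b u" "u' \<in> h u" for u b u'
  proof -
    have "a = b" "(w, u) \<in> acc M a"
      using M.vertex_eq_iff[OF w(2)] u(3) by auto
    moreover have "(w', u') \<in> acc N a"
      using frame_morphism_acc[OF frame_morphism _ w(3) u(4)] calculation by blast
    ultimately show ?thesis
      using N.vertex_eq_iff N.acc_live(1) by blast
  qed
  have "(THE v'. \<forall>u\<in>worlds M. \<forall>b\<in>live M u. vertex M a w = vertex M b u \<longrightarrow>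
      (\<forall>u'\<in>h u. v' = vertex N b u')) = vertex N a w'"
  proof (rule the_equality)
    show "\<forall>u\<in>worlds M. \<forall>b\<in>live M u. vertex M a w = vertex M b u \<longrightarrow>
        (\<forall>u'\<in>h u. vertex N a w' = vertex N b u')"
      by (intro ballI impI eq)
  qed (use w in blast)
  then show ?thesis
    using w M.vertex_mem unfolding sigma_mor_def by auto
qed

text \<open>From left to right, compare with some \<open>u\<close> in \<open>h w\<close>: each
  vertex of \<open>u\<close> at an agent live at \<open>w\<close> lies around \<open>w'\<close>, so
  \<open>w'\<close> belongs to the saturation of \<open>u\<close>, which is
  \<open>h w\<close>.\<close>

lemma sigma_mor_world_facet:
  assumes w: "w \<in> worlds M" and w': "w' \<in> worlds N"
  shows "sigma_mor M N h ` world_facet M w \<subseteq> world_facet N w' \<longleftrightarrow> w' \<in> h w"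
proof
  assume *: "sigma_mor M N h ` world_facet M w \<subseteq> world_facet N w'"
  obtain u where u: "u \<in> h w"
    using frame_morphism_nonempty[OF frame_morphism w] .
  have "(u, w') \<in> acc N a" if a: "a \<in> live M w" for a
  proof -
    have "sigma_mor M N h (vertex M a w) \<in> world_facet N w'"
      using * M.vertex_mem[OF a] by blast
    moreover have "a \<in> live N u"
      using frame_morphism_live[OF frame_morphism u] a by blast
    ultimately show ?thesis
      using sigma_mor_vertex[OF w a u] N.vertex_in_world_facet by simp
  qed
  then show "w' \<in> h w"
    using frame_morphism_eq_sat[OF N.frame frame_morphism w u] w' by (simp add: sat_def)
next
  assume u: "w' \<in> h w"
  show "sigma_mor M N h ` world_facet M w \<subseteq> world_facet N w'"
  proof
    fix v'
    assume "v' \<in> sigma_mor M N h ` world_facet M w"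
    then obtain a where a: "a \<in> live M w" "v' = sigma_mor M N h (vertex M a w)"
      by (auto elim: M.world_facetE)
    then show "v' \<in> world_facet N w'"
      using sigma_mor_vertex[OF w a(1) u] N.vertex_mem frame_morphism_live[OF frame_morphism u] by auto
  qed
qed

lemma sigma_mor_in_facet:
  assumes "w \<in> worlds M"
  obtains w' where "w' \<in> worlds N" "sigma_mor M N h ` world_facet M w \<subseteq> world_facet N w'"
  using assms frame_morphism_nonempty[OF frame_morphism assms] frame_morphism_worlds[OF frame_morphism assms]
    sigma_mor_world_facet by metis

lemma chromatic_map_sigma: "chromatic_map (sigma_ob M) (sigma_ob N) (sigma_mor M N h)"
proof -
  have "sigma_mor M N h v \<in> verts (sigma_ob N)
      \<and> colour (sigma_ob N) (sigma_mor M N h v) = colour (sigma_ob M) v"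
    if v: "v \<in> verts (sigma_ob M)" for v
  proof -
    obtain w where w: "w \<in> worlds M" "v \<in> world_facet M w"
      using v unfolding M.verts_sigma by blast
    obtain a where a: "a \<in> live M w" "v = vertex M a w"
      using w(2) by (rule M.world_facetE)
    obtain u where u: "u \<in> h w"
      using frame_morphism_nonempty[OF frame_morphism w(1)] .
    have u': "u \<in> worlds N" "a \<in> live N u"
      using frame_morphism_worlds[OF frame_morphism w(1) u] frame_morphism_live[OF frame_morphism u] a by auto
    then show ?thesis
      unfolding a(2) sigma_mor_vertex[OF w(1) a(1) u] N.verts_sigma
      using N.colour_sigma[OF u'] M.colour_sigma[OF w(1) a(1)] N.vertex_mem[OF u'(2)] u'(1) by auto
  qed
  moreover have "sigma_mor M N h ` X \<in> simps (sigma_ob N)" if X: "X \<in> simps (sigma_ob M)" for X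
  proof -
    obtain w where w: "X \<noteq> {}" "w \<in> worlds M" "X \<subseteq> world_facet M w"
      using X unfolding M.simps_sigma by blast
    obtain u where "u \<in> worlds N" "sigma_mor M N h ` world_facet M w \<subseteq> world_facet N u"
      using sigma_mor_in_facet[OF w(2)] .
    then show ?thesis
      using w unfolding N.simps_sigma by blast
  qed
  moreover have "sigma_mor M N h v = undefined" if "v \<notin> verts (sigma_ob M)" for v
    using that unfolding M.verts_sigma sigma_mor_def by simp
  ultimately show ?thesis
    unfolding chromatic_map_def by (intro conjI ballI PiE_I) blast+
qed

text \<open>The facets above the image of \<open>world_facet M w\<close> belong exactly to the
  members of \<open>h w\<close>, so no further label comparison arises.\<close>

lemma simplicial_morphism_sigma:
  assumes "epistemic_morphism AP M N h"
  shows "simplicial_morphism AP (sigma_ob M) (sigma_ob N) (sigma_mor M N h)"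
  unfolding simplicial_morphism_def M.facets_sigma N.facets_sigma
proof (intro conjI ballI impI chromatic_map_sigma)
  fix X Y
  assume "X \<in> world_facet M ` worlds M" "Y \<in> world_facet N ` worlds N"
    and *: "sigma_mor M N h ` X \<subseteq> Y"
  then obtain w u where w: "w \<in> worlds M" "X = world_facet M w"
    and u: "u \<in> worlds N" "Y = world_facet N u"
    by blast
  have "u \<in> h w"
    using * sigma_mor_world_facet[OF w(1) u(1)] w u by blast
  then show "flabel (sigma_ob N) Y \<inter> AP_on AP (colour (sigma_ob M) ` X) =
      flabel (sigma_ob M) X \<inter> AP_on AP (colour (sigma_ob M) ` X)"
    using assms w u M.colour_world_facet M.label_sigma N.label_sigma
    unfolding epistemic_morphism_def by simp
qed

end

lemma chromatic_map_eqI: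
  assumes "chromatic_map C D f" "chromatic_map C D g" "\<And>v. v \<in> verts C \<Longrightarrow> f v = g v"
  shows "f = g"
  using assms(1,2) unfolding chromatic_map_def
  by (intro PiE_ext[of f "verts C" "\<lambda>_. verts D" g] assms(3)) blast+

lemma (in emod) sigma_mor_id: "sigma_mor M M (frame_id M) = (\<lambda>v\<in>verts (sigma_ob M). v)"
proof -
  interpret frame_map A AP M M "frame_id M"
    by unfold_locales (rule frame_morphism_id[OF frame])
  show ?thesis
  proof (rule chromatic_map_eqI[OF chromatic_map_sigma chromatic_map_id[OF complex_sigma]])
    fix v
    assume v: "v \<in> verts (sigma_ob M)"
    then obtain w where w: "w \<in> worlds M" "v \<in> world_facet M w"
      unfolding verts_sigma by blast
    obtain a where a: "a \<in> live M w" "v = vertex M a w"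
      using w(2) by (rule world_facetE)
    show "sigma_mor M M (frame_id M) v = (\<lambda>v\<in>verts (sigma_ob M). v) v"
      using sigma_mor_vertex[OF w(1) a(1) frame_id_mem[OF w(1)]] a(2) v by simp
  qed
qed

text \<open>Along a chain from \<open>w\<close> through \<open>x\<close> to \<open>y\<close>, both
  sides send the vertex of \<open>a\<close> at \<open>w\<close> to the vertex of \<open>a\<close> at
  \<open>y\<close>.\<close>

lemma sigma_mor_comp:
  assumes "frame_map A AP L M f" "frame_map A AP M N g"
  shows "sigma_mor L N (frame_comp L N g f) =
    compose (verts (sigma_ob L)) (sigma_mor M N g) (sigma_mor L M f)"
proof -
  interpret f: frame_map A AP L M f by fact
  interpret g: frame_map A AP M N g by fact
  interpret gf: frame_map A AP L N "frame_comp L N g f"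
    by unfold_locales (rule frame_morphism_comp[OF f.M.frame g.N.frame f.frame_morphism g.frame_morphism])
  show ?thesis
  proof (rule chromatic_map_eqI[OF gf.chromatic_map_sigma
        chromatic_map_comp[OF f.M.complex_sigma f.chromatic_map_sigma g.chromatic_map_sigma]])
    fix v
    assume v: "v \<in> verts (sigma_ob L)"
    then obtain w where w: "w \<in> worlds L" "v \<in> world_facet L w"
      unfolding f.M.verts_sigma by blast
    obtain a where a: "a \<in> live L w" "v = vertex L a w"
      using w(2) by (rule f.M.world_facetE)
    obtain x where x: "x \<in> f w"
      using frame_morphism_nonempty[OF f.frame_morphism w(1)] .
    have x': "x \<in> worlds M" "a \<in> live M x"
      using frame_morphism_worlds[OF f.frame_morphism w(1) x] frame_morphism_live[OF f.frame_morphism x] a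
      by auto
    obtain y where y: "y \<in> g x"
      using frame_morphism_nonempty[OF g.frame_morphism x'(1)] .
    have "y \<in> frame_comp L N g f w"
      using frame_comp_mem[OF g.N.frame f.frame_morphism g.frame_morphism w(1) x y] .
    then show "sigma_mor L N (frame_comp L N g f) v =
        compose (verts (sigma_ob L)) (sigma_mor M N g) (sigma_mor L M f) v"
      using v a(2) f.sigma_mor_vertex[OF w(1) a(1) x] g.sigma_mor_vertex[OF x' y]
        gf.sigma_mor_vertex[OF w(1) a(1)]
      by (simp add: compose_def)
  qed
qed

section \<open>Unit and counit\<close>

lemma (in smod) emod_kappa: "emod A AP (kappa_ob C)"
  using finite_agents model_kappa proper_kappa small_kappa by unfold_locales

lemma (in emod) smod_sigma: "smod A AP (sigma_ob M)"
  using finite_agents model_sigma small_sigma by unfold_locales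

lemma (in chromatic) frame_map_kappa: "frame_map A AP (kappa_ob C) (kappa_ob D) (kappa_mor C D f)"
  using C.emod_kappa D.emod_kappa frame_morphism_kappa
  by (simp add: frame_map_def frame_map_axioms_def)

lemma (in frame_map) chromatic_sigma: "chromatic A AP (sigma_ob M) (sigma_ob N) (sigma_mor M N h)"
  using M.smod_sigma N.smod_sigma chromatic_map_sigma
  by (simp add: chromatic_def chromatic_axioms_def)

text \<open>A facet lies below no facet but itself, so the label condition compares \<open>X\<close>
  with its own image only.\<close>

lemma simplicial_morphism_facetsI:
  assumes "chromatic_map C D f"
    and "\<And>X. X \<in> facets C \<Longrightarrow> f ` X \<in> facets D \<and> flabel D (f ` X) = flabel C X"
  shows "simplicial_morphism AP C D f"
  unfolding simplicial_morphism_def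
proof (intro conjI ballI impI assms(1))
  fix X Y
  assume "X \<in> facets C" and Y: "Y \<in> facets D" "f ` X \<subseteq> Y"
  then have fX: "f ` X \<in> facets D" "flabel D (f ` X) = flabel C X"
    using assms(2) by auto
  have "Y = f ` X"
    using fX(1) Y unfolding facets_def mem_Collect_eq by simp
  then show "flabel D Y \<inter> AP_on AP (colour C ` X) = flabel C X \<inter> AP_on AP (colour C ` X)"
    using fX(2) by simp
qed

text \<open>The class of a facet around \<open>v\<close> for the colour of \<open>v\<close> is the
  set of all facets containing \<open>v\<close>, whichever facet is chosen. Writing it with
  \<open>vertex\<close> makes the results on \<open>sigma_ob\<close> applicable.\<close>

definition simplicial_unit ::
    "('a, 'p, ('a, 'b, 'k) univ) smodel \<Rightarrow> ('a, 'b, 'k) univ \<Rightarrow> ('a, 'b, 'k) univ" where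
  "simplicial_unit C =
     (\<lambda>v\<in>verts C. vertex (kappa_ob C) (colour C v) (vset (SOME X. X \<in> facets C \<and> v \<in> X)))"

context smod
begin

interpretation K: emod A AP "kappa_ob C"
  by (rule emod_kappa)

interpretation S: smod A AP "sigma_ob (kappa_ob C)"
  by (rule K.smod_sigma)

lemma live_kappaI: "X \<in> facets C \<Longrightarrow> v \<in> X \<Longrightarrow> colour C v \<in> live (kappa_ob C) (vset X)"
  using live_kappa by blast

text \<open>The chosen facet and \<open>X\<close> share \<open>v\<close>, so they lie in the same
  class for its colour.\<close>

lemma unit_vertex:
  assumes X: "X \<in> facets C" "v \<in> X"
  shows "simplicial_unit C v = vertex (kappa_ob C) (colour C v) (vset X)"
proof -
  define Y where "Y = (SOME X. X \<in> facets C \<and> v \<in> X)"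
  have "\<exists>X. X \<in> facets C \<and> v \<in> X"
    using X by blast
  then have Y: "Y \<in> facets C" "v \<in> Y"
    unfolding Y_def by (rule someI2_ex, simp)+
  have "(vset Y, vset X) \<in> acc (kappa_ob C) (colour C v)"
    using Y(1) X(1) Y(2) X(2) by (rule acc_kappaI)
  then have "vertex (kappa_ob C) (colour C v) (vset Y) = vertex (kappa_ob C) (colour C v) (vset X)"
    using K.vertex_eq_iff[OF live_kappaI[OF Y]] by simp
  then show ?thesis
    using facet_verts[OF X] by (simp add: simplicial_unit_def Y_def)
qed

lemma unit_facet:
  assumes X: "X \<in> facets C"
  shows "simplicial_unit C ` X = world_facet (kappa_ob C) (vset X)"
proof -
  have "world_facet (kappa_ob C) (vset X) = (\<lambda>a. vertex (kappa_ob C) a (vset X)) ` colour C ` X"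
    unfolding world_facet_def live_kappa[OF X] by blast
  also have "\<dots> = simplicial_unit C ` X"
    unfolding image_image using unit_vertex[OF X] by (intro image_cong) simp_all
  finally show ?thesis ..
qed

text \<open>Equal images force a vertex common to both facets with the common colour of
  \<open>v\<close> and \<open>v'\<close>; it equals \<open>v\<close> in one facet and
  \<open>v'\<close> in the other.\<close>

lemma unit_inj: "inj_on (simplicial_unit C) (verts C)"
proof (rule inj_onI)
  fix v v'
  assume v: "v \<in> verts C" and v': "v' \<in> verts C" and eq: "simplicial_unit C v = simplicial_unit C v'"
  obtain X where X: "X \<in> facets C" "v \<in> X"
    using vertex_in_facet[OF v] .
  obtain Y where Y: "Y \<in> facets C" "v' \<in> Y"
    using vertex_in_facet[OF v'] .
  have *: "colour C v = colour C v'" "(vset X, vset Y) \<in> acc (kappa_ob C) (colour C v)"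
    using eq K.vertex_eq_iff[OF live_kappaI[OF X]] unfolding unit_vertex[OF X] unit_vertex[OF Y] by auto
  then obtain u where "u \<in> X" "u \<in> Y" "colour C u = colour C v"
    using acc_kappa[OF X(1) Y(1)] by auto
  then show "v = v'"
    using facet_colour_inj X Y * by metis
qed

lemma unit_verts: "simplicial_unit C ` verts C = verts (sigma_ob (kappa_ob C))"
proof -
  have "verts C = \<Union>(facets C)"
    by (auto intro: facet_verts elim: vertex_in_facet)
  then have "simplicial_unit C ` verts C = (\<Union>X\<in>facets C. simplicial_unit C ` X)"
    by blast
  then show ?thesis
    unfolding K.verts_sigma worlds_kappa using unit_facet by simp
qed

lemma facets_sigma_kappa: "facets (sigma_ob (kappa_ob C)) = (\<lambda>X. simplicial_unit C ` X) ` facets C"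
  unfolding K.facets_sigma worlds_kappa image_image using unit_facet by (intro image_cong) simp_all

lemma unit_label: "X \<in> facets C \<Longrightarrow> flabel (sigma_ob (kappa_ob C)) (simplicial_unit C ` X) = flabel C X"
  using K.label_sigma label_kappa unit_facet worlds_kappa by simp

lemma unit_colour: "v \<in> verts C \<Longrightarrow> colour (sigma_ob (kappa_ob C)) (simplicial_unit C v) = colour C v"
proof -
  assume v: "v \<in> verts C"
  obtain X where X: "X \<in> facets C" "v \<in> X"
    using vertex_in_facet[OF v] .
  then show ?thesis
    using K.colour_sigma[OF _ live_kappaI[OF X]] unit_vertex[OF X] worlds_kappa by simp
qed

lemma unit_chromatic: "chromatic_map C (sigma_ob (kappa_ob C)) (simplicial_unit C)"
proof -
  have "simplicial_unit C ` X \<in> simps (sigma_ob (kappa_ob C))" if X: "X \<in> simps C" for X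
  proof -
    obtain Z where Z: "Z \<in> facets C" "X \<subseteq> Z"
      using simplex_in_facet[OF X] .
    then have "simplicial_unit C ` Z \<in> simps (sigma_ob (kappa_ob C))"
      by (intro S.facet_simplex) (simp add: facets_sigma_kappa)
    then show ?thesis
      by (rule S.complexD(4)) (simp add: complexD(1)[OF X], rule image_mono[OF Z(2)])
  qed
  moreover have "simplicial_unit C \<in> verts C \<rightarrow>\<^sub>E verts (sigma_ob (kappa_ob C))"
    using unit_verts by (intro PiE_I) (auto simp: simplicial_unit_def)
  ultimately show ?thesis
    unfolding chromatic_map_def using unit_colour by blast
qed

lemma unit_morphism: "simplicial_morphism AP C (sigma_ob (kappa_ob C)) (simplicial_unit C)"
  using unit_chromatic by (rule simplicial_morphism_facetsI) (simp add: facets_sigma_kappa unit_label)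

definition unit_inverse :: "('a, 'b, 'k) univ \<Rightarrow> ('a, 'b, 'k) univ" where
  "unit_inverse = (\<lambda>u\<in>verts (sigma_ob (kappa_ob C)). inv_into (verts C) (simplicial_unit C) u)"

lemma unit_inverse_unit: "v \<in> verts C \<Longrightarrow> unit_inverse (simplicial_unit C v) = v"
  unfolding unit_inverse_def using unit_verts unit_inj by auto

lemma unit_inverse_image: "X \<subseteq> verts C \<Longrightarrow> unit_inverse ` simplicial_unit C ` X = X"
  unfolding image_image using unit_inverse_unit by (simp add: subset_iff)

text \<open>A bijective simplicial map need not have a simplicial inverse. Here it does, since every
  simplex of the target lies in the image of a facet.\<close>

lemma unit_inverse_chromatic: "chromatic_map (sigma_ob (kappa_ob C)) C unit_inverse"
proof -
  have "unit_inverse Y \<in> verts C \<and> colour C (unit_inverse Y) = colour (sigma_ob (kappa_ob C)) Y"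
    if "Y \<in> verts (sigma_ob (kappa_ob C))" for Y
    using that unit_inverse_unit unit_colour unfolding unit_verts[symmetric] by auto
  moreover have "unit_inverse ` Y \<in> simps C" if Y: "Y \<in> simps (sigma_ob (kappa_ob C))" for Y
  proof -
    obtain Y' where "Y' \<in> facets (sigma_ob (kappa_ob C))" "Y \<subseteq> Y'"
      using S.simplex_in_facet[OF Y] .
    then obtain Z where Z: "Z \<in> facets C" "Y \<subseteq> simplicial_unit C ` Z"
      unfolding facets_sigma_kappa by blast
    have "Z \<subseteq> verts C"
      using facet_verts[OF Z(1)] by blast
    then have "unit_inverse ` Y \<subseteq> Z"
      using image_mono[OF Z(2)] unit_inverse_image by metis
    then show ?thesis
      using complexD(4)[OF facet_simplex[OF Z(1)]] S.complexD(1)[OF Y] by simp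
  qed
  moreover have "unit_inverse Y = undefined" if "Y \<notin> verts (sigma_ob (kappa_ob C))" for Y
    using that by (simp add: unit_inverse_def)
  ultimately show ?thesis
    unfolding chromatic_map_def by (intro conjI ballI PiE_I) blast+
qed

lemma unit_inverse_morphism: "simplicial_morphism AP (sigma_ob (kappa_ob C)) C unit_inverse"
proof (rule simplicial_morphism_facetsI[OF unit_inverse_chromatic])
  fix Y
  assume "Y \<in> facets (sigma_ob (kappa_ob C))"
  then obtain X where X: "X \<in> facets C" "Y = simplicial_unit C ` X"
    unfolding facets_sigma_kappa by blast
  then have "X \<subseteq> verts C"
    using facet_verts by blast
  then show "unit_inverse ` Y \<in> facets C \<and> flabel C (unit_inverse ` Y) = flabel (sigma_ob (kappa_ob C)) Y"
    using X unit_inverse_image unit_label by simp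
qed

lemma unit_inverse_comp:
  "compose (verts C) unit_inverse (simplicial_unit C) = (\<lambda>v\<in>verts C. v)"
  "compose (verts (sigma_ob (kappa_ob C))) (simplicial_unit C) unit_inverse =
    (\<lambda>v\<in>verts (sigma_ob (kappa_ob C)). v)"
  unfolding compose_def unit_verts[symmetric] using unit_inverse_unit
  by (auto intro!: restrict_ext)

lemma identity_morphism: "simplicial_morphism AP C C (\<lambda>v\<in>verts C. v)"
proof (rule simplicial_morphism_facetsI[OF chromatic_map_id[OF complex]])
  fix X
  assume X: "X \<in> facets C"
  then have "(\<lambda>v\<in>verts C. v) ` X = X"
    using facet_verts by (auto simp: image_iff)
  then show "(\<lambda>v\<in>verts C. v) ` X \<in> facets C \<and> flabel C ((\<lambda>v\<in>verts C. v) ` X) = flabel C X"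
    using X by simp
qed

end

text \<open>With \<open>v\<close> in \<open>X\<close> and a facet \<open>Z\<close> above the image
  of \<open>X\<close>, both routes end in the vertex at \<open>Z\<close> with the colour of
  \<open>v\<close>.\<close>

lemma (in chromatic) unit_natural:
  "compose (verts C) (simplicial_unit D) f =
    compose (verts C) (sigma_mor (kappa_ob C) (kappa_ob D) (kappa_mor C D f)) (simplicial_unit C)"
proof -
  interpret K: frame_map A AP "kappa_ob C" "kappa_ob D" "kappa_mor C D f"
    by (rule frame_map_kappa)
  have "simplicial_unit D (f v) = sigma_mor (kappa_ob C) (kappa_ob D) (kappa_mor C D f) (simplicial_unit C v)"
    if v: "v \<in> verts C" for v
  proof -
    obtain X where X: "X \<in> facets C" "v \<in> X"
      using C.vertex_in_facet[OF v] .
    obtain Z where Z: "Z \<in> facets D" "f ` X \<subseteq> Z"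
      using facet_image_in_facet[OF X(1)] .
    have "vset X \<in> worlds (kappa_ob C)" "vset Z \<in> kappa_mor C D f (vset X)"
      using X Z C.worlds_kappa kappa_mor_mem by auto
    then have "sigma_mor (kappa_ob C) (kappa_ob D) (kappa_mor C D f) (simplicial_unit C v) =
        vertex (kappa_ob D) (colour C v) (vset Z)"
      unfolding C.unit_vertex[OF X] using C.live_kappaI[OF X] by (intro K.sigma_mor_vertex)
    moreover have "simplicial_unit D (f v) = vertex (kappa_ob D) (colour C v) (vset Z)"
      using D.unit_vertex[OF Z(1), of "f v"] X(2) Z(2) colour_map[OF v] by auto
    ultimately show ?thesis
      by simp
  qed
  then show ?thesis
    unfolding compose_def by (intro restrict_ext) simp
qed

section \<open>Identities of proper frames, and the counit\<close>

lemma (in emod) frame_id_singleton: "w \<in> worlds M \<Longrightarrow> frame_id M w = {w}"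
proof -
  assume w: "w \<in> worlds M"
  have "u = w" if "u \<in> frame_id M w" for u
  proof (rule ccontr)
    assume "u \<noteq> w"
    have u: "u \<in> worlds M" "\<And>a. a \<in> live M w \<Longrightarrow> (w, u) \<in> acc M a"
      using that w by (auto simp: frame_id_def sat_def)
    \<comment> \<open>Properness separates \<open>w\<close> from every other world by an agent live
      at \<open>w\<close>.\<close>
    obtain a where "a \<in> live M w" "(w, u) \<notin> acc M a"
      using properE[OF w u(1)] \<open>u \<noteq> w\<close> by metis
    then show False
      using u(2) by blast
  qed
  then show ?thesis
    using frame_id_mem[OF w] by blast
qed

lemma (in emod) identity_epistemic_morphism: "epistemic_morphism AP M M (frame_id M)"
  unfolding epistemic_morphism_def using frame_morphism_id[OF frame] frame_id_singleton by simp

text \<open>As \<open>b\<close> preserves and reflects accessibility, \<open>w\<close> and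
  \<open>b w\<close> have the same live agents. The saturation of \<open>b w\<close> is then the
  value of the identity of \<open>N\<close>, a singleton by properness.\<close>

lemma epistemic_morphism_singletonI:
  assumes M: "emod A AP M" and N: "emod A AP N"
    and b: "\<And>w. w \<in> worlds M \<Longrightarrow> b w \<in> worlds N"
    and acc: "\<And>a u v. u \<in> worlds M \<Longrightarrow> v \<in> worlds M \<Longrightarrow> (b u, b v) \<in> acc N a \<longleftrightarrow> (u, v) \<in> acc M a"
    and label: "\<And>w. w \<in> worlds M \<Longrightarrow> wlabel N (b w) = wlabel M w"
  shows "epistemic_morphism AP M N (\<lambda>w\<in>worlds M. {b w})"
proof -
  interpret M: emod A AP M by fact
  interpret N: emod A AP N by fact
  have "(u', v') \<in> acc N a"
    if uv: "(u, v) \<in> acc M a" and "u' \<in> (\<lambda>w\<in>worlds M. {b w}) u" "v' \<in> (\<lambda>w\<in>worlds M. {b w}) v" for a u v u' v'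
    using that acc M.acc_worlds[OF uv] by simp
  moreover have "sat N (live M w) (b w) = {b w}" if w: "w \<in> worlds M" for w
  proof -
    have "live M w = live N (b w)"
      using acc[OF w w] unfolding live_def by simp
    then have "sat N (live M w) (b w) = frame_id N (b w)"
      using b[OF w] by (simp add: frame_id_def)
    then show ?thesis
      using N.frame_id_singleton b[OF w] by simp
  qed
  moreover have "(\<lambda>w\<in>worlds M. {b w}) \<in> worlds M \<rightarrow>\<^sub>E Pow (worlds N)"
    using b by simp
  ultimately show ?thesis
    unfolding epistemic_morphism_def frame_morphism_def using label by simp
qed

definition epistemic_counit ::
    "('a, 'p, ('a, 'b, 'k) univ) emodel \<Rightarrow> ('a, 'b, 'k) univ \<Rightarrow> ('a, 'b, 'k) univ set" where
  "epistemic_counit M =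
     (\<lambda>x\<in>worlds (kappa_ob (sigma_ob M)). {inv_into (worlds M) (\<lambda>w. vset (world_facet M w)) x})"

context emod
begin

interpretation S: smod A AP "sigma_ob M"
  by (rule smod_sigma)

interpretation K: emod A AP "kappa_ob (sigma_ob M)"
  by (rule S.emod_kappa)

lemma facet_sigma: "w \<in> worlds M \<Longrightarrow> world_facet M w \<in> facets (sigma_ob M)"
  unfolding facets_sigma by blast

lemma worlds_kappa_sigma: "worlds (kappa_ob (sigma_ob M)) = (\<lambda>w. vset (world_facet M w)) ` worlds M"
  unfolding S.worlds_kappa facets_sigma by (simp add: image_image)

lemma world_code_inj: "inj_on (\<lambda>w. vset (world_facet M w)) (worlds M)"
  by (intro inj_onI) (simp add: S.vset_facet_inj facet_sigma world_facet_inj)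

text \<open>The only vertex around \<open>u\<close> with colour \<open>a\<close> is the one of
  \<open>a\<close> at \<open>u\<close>, and it also lies around \<open>v\<close> precisely if
  \<open>a\<close> relates \<open>u\<close> and \<open>v\<close>.\<close>

lemma acc_kappa_sigma:
  assumes "u \<in> worlds M" "v \<in> worlds M"
  shows "(vset (world_facet M u), vset (world_facet M v)) \<in> acc (kappa_ob (sigma_ob M)) a \<longleftrightarrow>
    (u, v) \<in> acc M a"
  unfolding S.acc_kappa[OF facet_sigma[OF assms(1)] facet_sigma[OF assms(2)]]
proof
  assume "a \<in> colour (sigma_ob M) ` (world_facet M u \<inter> world_facet M v)"
  then obtain x where x: "x \<in> world_facet M u" "x \<in> world_facet M v" "a = colour (sigma_ob M) x"
    by blast
  obtain b where b: "b \<in> live M u" "x = vertex M b u"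
    using x(1) by (rule world_facetE)
  then have "a = b"
    using x(3) colour_sigma[OF assms(1)] by simp
  then show "(u, v) \<in> acc M a"
    using x(2) b vertex_in_world_facet by blast
next
  assume uv: "(u, v) \<in> acc M a"
  then have "vertex M a u \<in> world_facet M u \<inter> world_facet M v"
    using acc_live[OF uv] vertex_mem vertex_in_world_facet by blast
  moreover have "a = colour (sigma_ob M) (vertex M a u)"
    using colour_sigma[OF assms(1) acc_live(1)[OF uv]] by simp
  ultimately show "a \<in> colour (sigma_ob M) ` (world_facet M u \<inter> world_facet M v)"
    by (rule rev_image_eqI)
qed

lemma counit_world: "w \<in> worlds M \<Longrightarrow> epistemic_counit M (vset (world_facet M w)) = {w}"
  unfolding epistemic_counit_def worlds_kappa_sigma using inv_into_f_f[OF world_code_inj] by simp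

definition counit_inverse :: "('a, 'b, 'k) univ \<Rightarrow> ('a, 'b, 'k) univ set" where
  "counit_inverse = (\<lambda>w\<in>worlds M. {vset (world_facet M w)})"

lemma label_kappa_sigma:
  "w \<in> worlds M \<Longrightarrow> wlabel (kappa_ob (sigma_ob M)) (vset (world_facet M w)) = wlabel M w"
  using S.label_kappa facet_sigma label_sigma by simp

lemma counit_morphism: "epistemic_morphism AP (kappa_ob (sigma_ob M)) M (epistemic_counit M)"
  unfolding epistemic_counit_def
proof (rule epistemic_morphism_singletonI[OF K.emod_axioms emod_axioms])
  let ?b = "inv_into (worlds M) (\<lambda>w. vset (world_facet M w))"
  show "?b x \<in> worlds M" if "x \<in> worlds (kappa_ob (sigma_ob M))" for x
    using that inv_into_into unfolding worlds_kappa_sigma by metis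
  show "(?b x, ?b y) \<in> acc M a \<longleftrightarrow> (x, y) \<in> acc (kappa_ob (sigma_ob M)) a"
    if "x \<in> worlds (kappa_ob (sigma_ob M))" "y \<in> worlds (kappa_ob (sigma_ob M))" for a x y
    using that acc_kappa_sigma inv_into_f_f[OF world_code_inj] unfolding worlds_kappa_sigma by auto
  show "wlabel M (?b x) = wlabel (kappa_ob (sigma_ob M)) x"
    if "x \<in> worlds (kappa_ob (sigma_ob M))" for x
    using that label_kappa_sigma inv_into_f_f[OF world_code_inj] unfolding worlds_kappa_sigma by auto
qed

lemma counit_inverse_morphism: "epistemic_morphism AP M (kappa_ob (sigma_ob M)) counit_inverse"
  unfolding counit_inverse_def
  by (rule epistemic_morphism_singletonI[OF emod_axioms K.emod_axioms])
    (simp_all add: worlds_kappa_sigma acc_kappa_sigma label_kappa_sigma)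

lemma counit_inverse_world: "w \<in> worlds M \<Longrightarrow> counit_inverse w = {vset (world_facet M w)}"
  by (simp add: counit_inverse_def)

lemma counit_frame_morphism: "frame_morphism (kappa_ob (sigma_ob M)) M (epistemic_counit M)"
  using counit_morphism unfolding epistemic_morphism_def by blast

lemma counit_inverse_frame_morphism: "frame_morphism M (kappa_ob (sigma_ob M)) counit_inverse"
  using counit_inverse_morphism unfolding epistemic_morphism_def by blast

text \<open>Each round trip returns to the world it started from, which is also an endpoint of the
  identity.\<close>

lemma counit_inverse_comp:
  "frame_comp M M (epistemic_counit M) counit_inverse = frame_id M"
  "frame_comp (kappa_ob (sigma_ob M)) (kappa_ob (sigma_ob M)) counit_inverse (epistemic_counit M) =
    frame_id (kappa_ob (sigma_ob M))"
proof -
  have "\<exists>x u. x \<in> counit_inverse w \<and> u \<in> epistemic_counit M x \<and> u \<in> frame_id M w"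
    if w: "w \<in> worlds M" for w
    using counit_world[OF w] counit_inverse_world[OF w] frame_id_mem[OF w] by blast
  then show "frame_comp M M (epistemic_counit M) counit_inverse = frame_id M"
    by (rule frame_comp_eqI[OF frame counit_inverse_frame_morphism counit_frame_morphism
          frame_morphism_id[OF frame]])
  have "\<exists>w y. w \<in> epistemic_counit M x \<and> y \<in> counit_inverse w \<and> y \<in> frame_id (kappa_ob (sigma_ob M)) x"
    if x: "x \<in> worlds (kappa_ob (sigma_ob M))" for x
  proof -
    obtain w where w: "w \<in> worlds M" "x = vset (world_facet M w)"
      using x unfolding worlds_kappa_sigma by blast
    show ?thesis
      using counit_world[OF w(1)] counit_inverse_world[OF w(1)] frame_id_mem[OF x] w(2) by blast
  qed
  then show "frame_comp (kappa_ob (sigma_ob M)) (kappa_ob (sigma_ob M)) counit_inverse (epistemic_counit M) =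
      frame_id (kappa_ob (sigma_ob M))"
    by (rule frame_comp_eqI[OF K.frame counit_frame_morphism counit_inverse_frame_morphism
          frame_morphism_id[OF K.frame]])
qed

end

text \<open>Any \<open>u\<close> in \<open>h w\<close> is a common endpoint: one route passes
  through the facet of \<open>u\<close>, the other through \<open>w\<close>.\<close>

lemma (in frame_map) counit_natural:
  "frame_comp (kappa_ob (sigma_ob M)) N (epistemic_counit N)
      (kappa_mor (sigma_ob M) (sigma_ob N) (sigma_mor M N h)) =
    frame_comp (kappa_ob (sigma_ob M)) N h (epistemic_counit M)"
proof -
  interpret S: chromatic A AP "sigma_ob M" "sigma_ob N" "sigma_mor M N h"
    by (rule chromatic_sigma)
  show ?thesis
  proof (rule frame_comp_cong_point[OF N.frame S.frame_morphism_kappa N.counit_frame_morphism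
        M.counit_frame_morphism frame_morphism])
    fix x
    assume "x \<in> worlds (kappa_ob (sigma_ob M))"
    then obtain w where w: "w \<in> worlds M" "x = vset (world_facet M w)"
      unfolding M.worlds_kappa_sigma by blast
    obtain u where u: "u \<in> h w"
      using frame_morphism_nonempty[OF frame_morphism w(1)] .
    have u': "u \<in> worlds N"
      using frame_morphism_worlds[OF frame_morphism w(1) u] .
    have "vset (world_facet N u) \<in> kappa_mor (sigma_ob M) (sigma_ob N) (sigma_mor M N h) x"
      unfolding w(2) S.kappa_mor_mem[OF M.facet_sigma[OF w(1)] N.facet_sigma[OF u']]
        sigma_mor_world_facet[OF w(1) u'] by (rule u)
    moreover have "u \<in> epistemic_counit N (vset (world_facet N u))"
      unfolding N.counit_world[OF u'] by blast
    moreover have "w \<in> epistemic_counit M x"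
      unfolding w(2) M.counit_world[OF w(1)] by blast
    ultimately show "\<exists>v v' z. v \<in> kappa_mor (sigma_ob M) (sigma_ob N) (sigma_mor M N h) x \<and>
        z \<in> epistemic_counit N v \<and> v' \<in> epistemic_counit M x \<and> z \<in> h v'"
      using u by blast
  qed
qed

section \<open>The equivalences\<close>

lemma chromatic_models_simps:
  "Idn (chromatic_models A AP) = Idn (simplicial_models A AP)"
  "Cmp (chromatic_models A AP) = Cmp (simplicial_models A AP)"
  "Hom (chromatic_models A AP) C D = {f. chromatic_map C D f}"
  "Ob (chromatic_models A AP) = Ob (simplicial_models A AP)"
  by (simp_all add: chromatic_models_def)

lemma proper_frames_simps:
  "Idn (proper_frames A AP) = Idn (proper_epistemic_models A AP)"
  "Cmp (proper_frames A AP) = Cmp (proper_epistemic_models A AP)"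
  "Hom (proper_frames A AP) M N = {h. frame_morphism M N h}"
  "Ob (proper_frames A AP) = Ob (proper_epistemic_models A AP)"
  by (simp_all add: proper_frames_def)

lemma simplicial_models_simps:
  "Idn (simplicial_models A AP) C = (\<lambda>v\<in>verts C. v)"
  "Cmp (simplicial_models A AP) C D E g f = compose (verts C) g f"
  "Hom (simplicial_models A AP) C D = {f. simplicial_morphism AP C D f}"
  by (simp_all add: simplicial_models_def)

lemma proper_epistemic_models_simps:
  "Idn (proper_epistemic_models A AP) M = frame_id M"
  "Cmp (proper_epistemic_models A AP) M N K g f = frame_comp M K g f"
  "Hom (proper_epistemic_models A AP) M N = {h. epistemic_morphism AP M N h}"
  by (simp_all add: proper_epistemic_models_def)

lemma Ob_simplicial_models: "finite A \<Longrightarrow> C \<in> Ob (simplicial_models A AP) \<longleftrightarrow> smod A AP C"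
  by (simp add: simplicial_models_def smod_def)

lemma Ob_proper_epistemic_models:
  "finite A \<Longrightarrow> M \<in> Ob (proper_epistemic_models A AP) \<longleftrightarrow> emod A AP M"
  by (auto simp: proper_epistemic_models_def emod_def)

lemma pointed_simplicial_models_simps:
  "Idn (pointed_simplicial_models A AP) CX = Idn (simplicial_models A AP) (fst CX)"
  "Cmp (pointed_simplicial_models A AP) CX DY EZ =
    Cmp (simplicial_models A AP) (fst CX) (fst DY) (fst EZ)"
  "Hom (pointed_simplicial_models A AP) CX DY =
    {f. simplicial_morphism AP (fst CX) (fst DY) f \<and> f ` snd CX \<subseteq> snd DY}"
  "CX \<in> Ob (pointed_simplicial_models A AP) \<longleftrightarrow>
    fst CX \<in> Ob (simplicial_models A AP) \<and> snd CX \<in> facets (fst CX)"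
  by (auto simp: pointed_simplicial_models_def simplicial_models_simps split: prod.splits)

lemma pointed_proper_epistemic_models_simps:
  "Idn (pointed_proper_epistemic_models A AP) Mw = Idn (proper_epistemic_models A AP) (fst Mw)"
  "Cmp (pointed_proper_epistemic_models A AP) Mw Nu Kx =
    Cmp (proper_epistemic_models A AP) (fst Mw) (fst Nu) (fst Kx)"
  "Hom (pointed_proper_epistemic_models A AP) Mw Nu =
    {h. epistemic_morphism AP (fst Mw) (fst Nu) h \<and> snd Nu \<in> h (snd Mw)}"
  "Mw \<in> Ob (pointed_proper_epistemic_models A AP) \<longleftrightarrow>
    fst Mw \<in> Ob (proper_epistemic_models A AP) \<and> snd Mw \<in> worlds (fst Mw)"
  by (auto simp: pointed_proper_epistemic_models_def proper_epistemic_models_simps split: prod.splits)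

lemma kappa_simps [simp]: "on_ob kappa = kappa_ob" "on_mor kappa = kappa_mor"
  by (simp_all add: kappa_def)

lemma sigma_simps [simp]: "on_ob sigma = sigma_ob" "on_mor sigma = sigma_mor"
  by (simp_all add: sigma_def)

lemma pointed_kappa_simps [simp]:
  "on_ob pointed_kappa CX = (kappa_ob (fst CX), vset (snd CX))"
  "on_mor pointed_kappa CX DY = kappa_mor (fst CX) (fst DY)"
  by (simp_all add: pointed_kappa_def split: prod.splits)

lemma pointed_sigma_simps [simp]:
  "on_ob pointed_sigma Mw = (sigma_ob (fst Mw), world_facet (fst Mw) (snd Mw))"
  "on_mor pointed_sigma Mw Nu = sigma_mor (fst Mw) (fst Nu)"
  by (simp_all add: pointed_sigma_def split: prod.splits)

lemma chromaticI: "smod A AP C \<Longrightarrow> smod A AP D \<Longrightarrow> chromatic_map C D f \<Longrightarrow> chromatic A AP C D f"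
  by (simp add: chromatic_def chromatic_axioms_def)

lemma frame_mapI: "emod A AP M \<Longrightarrow> emod A AP N \<Longrightarrow> frame_morphism M N h \<Longrightarrow> frame_map A AP M N h"
  by (simp add: frame_map_def frame_map_axioms_def)

lemma simplicial_morphism_chromatic: "simplicial_morphism AP C D f \<Longrightarrow> chromatic_map C D f"
  unfolding simplicial_morphism_def by blast

lemma epistemic_morphism_frame: "epistemic_morphism AP M N h \<Longrightarrow> frame_morphism M N h"
  unfolding epistemic_morphism_def by blast

context
  fixes A :: "'a set" and AP :: "'a \<Rightarrow> 'p set"
  assumes finite_A: "finite A"
begin

abbreviation (input) smodels :: "(('a, 'p, ('a, 'b, 'k::infinite) univ) smodel,
    ('a, 'b, 'k) univ \<Rightarrow> ('a, 'b, 'k) univ) cat" where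
  "smodels \<equiv> simplicial_models A AP"

abbreviation (input) emodels :: "(('a, 'p, ('a, 'b, 'k::infinite) univ) emodel,
    ('a, 'b, 'k) univ \<Rightarrow> ('a, 'b, 'k) univ set) cat" where
  "emodels \<equiv> proper_epistemic_models A AP"

abbreviation (input) pointed_smodels :: "(('a, 'p, ('a, 'b, 'k::infinite) univ) smodel \<times> ('a, 'b, 'k) univ set,
    ('a, 'b, 'k) univ \<Rightarrow> ('a, 'b, 'k) univ) cat" where
  "pointed_smodels \<equiv> pointed_simplicial_models A AP"

abbreviation (input) pointed_emodels :: "(('a, 'p, ('a, 'b, 'k::infinite) univ) emodel \<times> ('a, 'b, 'k) univ,
    ('a, 'b, 'k) univ \<Rightarrow> ('a, 'b, 'k) univ set) cat" where
  "pointed_emodels \<equiv> pointed_proper_epistemic_models A AP"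

abbreviation (input) chromatics :: "(('a, 'p, ('a, 'b, 'k::infinite) univ) smodel,
    ('a, 'b, 'k) univ \<Rightarrow> ('a, 'b, 'k) univ) cat" where
  "chromatics \<equiv> chromatic_models A AP"

abbreviation (input) frames :: "(('a, 'p, ('a, 'b, 'k::infinite) univ) emodel,
    ('a, 'b, 'k) univ \<Rightarrow> ('a, 'b, 'k) univ set) cat" where
  "frames \<equiv> proper_frames A AP"

lemmas Ob_smodels = Ob_simplicial_models[OF finite_A]
lemmas Ob_emodels = Ob_proper_epistemic_models[OF finite_A]

lemma is_functor_kappa: "is_functor chromatics frames kappa"
  unfolding is_functor_def maps_homs_def
  by (simp add: chromatic_models_simps proper_frames_simps simplicial_models_simps
      proper_epistemic_models_simps Ob_smodels Ob_emodels smod.emod_kappa[of A AP] smod.kappa_mor_id[of A AP]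
      chromatic.frame_morphism_kappa[OF chromaticI[of A AP]] kappa_mor_comp[OF chromaticI[of A AP] chromaticI[of A AP]])

lemma is_functor_sigma: "is_functor frames chromatics sigma"
  unfolding is_functor_def maps_homs_def
  by (simp add: chromatic_models_simps proper_frames_simps simplicial_models_simps
      proper_epistemic_models_simps Ob_smodels Ob_emodels emod.smod_sigma[of A AP] emod.sigma_mor_id[of A AP]
      frame_map.chromatic_map_sigma[OF frame_mapI[of A AP]] sigma_mor_comp[OF frame_mapI[of A AP] frame_mapI[of A AP]])

lemma lies_over_chromatic: "lies_over smodels chromatics (\<lambda>C. C)"
  unfolding lies_over_def
  by (auto simp: chromatic_models_simps simplicial_models_simps Ob_smodels smod.identity_morphism[of A AP]
      simplicial_morphism_chromatic)

lemma lies_over_frames: "lies_over emodels frames (\<lambda>M. M)"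
  unfolding lies_over_def
  by (auto simp: proper_frames_simps proper_epistemic_models_simps Ob_emodels
      emod.identity_epistemic_morphism[of A AP] epistemic_morphism_frame)

lemma lies_over_chromatic_pointed: "lies_over pointed_smodels chromatics fst"
  unfolding lies_over_def
  by (auto simp: chromatic_models_simps simplicial_models_simps pointed_simplicial_models_simps
      Ob_smodels smod.identity_morphism[of A AP] smod.facet_verts[of A AP] simplicial_morphism_chromatic)

lemma lies_over_frames_pointed: "lies_over pointed_emodels frames fst"
  unfolding lies_over_def
  by (auto simp: proper_frames_simps proper_epistemic_models_simps
      pointed_proper_epistemic_models_simps Ob_emodels
      emod.identity_epistemic_morphism[of A AP] epistemic_morphism_frame frame_id_mem)

lemma maps_homs_kappa: "maps_homs smodels emodels kappa"
  unfolding maps_homs_def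
  by (auto simp: simplicial_models_simps proper_epistemic_models_simps Ob_smodels Ob_emodels
      smod.emod_kappa[of A AP] intro: chromatic.epistemic_morphism_kappa[OF chromaticI[of A AP]]
      simplicial_morphism_chromatic)

lemma maps_homs_sigma: "maps_homs emodels smodels sigma"
  unfolding maps_homs_def
  by (auto simp: simplicial_models_simps proper_epistemic_models_simps Ob_smodels Ob_emodels
      emod.smod_sigma[of A AP] intro: frame_map.simplicial_morphism_sigma[OF frame_mapI[of A AP]]
      epistemic_morphism_frame)

lemma maps_homs_pointed_kappa: "maps_homs pointed_smodels pointed_emodels pointed_kappa"
  unfolding maps_homs_def
proof (intro conjI ballI)
  fix CX
  assume "CX \<in> Ob pointed_smodels"
  then show "on_ob pointed_kappa CX \<in> Ob pointed_emodels"
    by (simp add: pointed_simplicial_models_simps pointed_proper_epistemic_models_simps Ob_smodels Ob_emodels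
        smod.emod_kappa[of A AP] smod.worlds_kappa[of A AP])
next
  fix CX DY f
  assume *: "CX \<in> Ob pointed_smodels" "DY \<in> Ob pointed_smodels" "f \<in> Hom pointed_smodels CX DY"
  then have f: "simplicial_morphism AP (fst CX) (fst DY) f" "f ` snd CX \<subseteq> snd DY"
    and X: "snd CX \<in> facets (fst CX)" "snd DY \<in> facets (fst DY)"
    by (auto simp: pointed_simplicial_models_simps)
  interpret chromatic A AP "fst CX" "fst DY" f
    using * f by (intro chromaticI simplicial_morphism_chromatic)
      (auto simp: pointed_simplicial_models_simps Ob_smodels)
  show "on_mor pointed_kappa CX DY f \<in> Hom pointed_emodels (on_ob pointed_kappa CX) (on_ob pointed_kappa DY)"
    using epistemic_morphism_kappa[OF f(1)] kappa_mor_mem[OF X] f(2)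
    by (simp add: pointed_proper_epistemic_models_simps)
qed

text \<open>The point conditions on the two sides are equivalent by
  \<open>sigma_mor_world_facet\<close>; dually, \<open>kappa_mor_mem\<close> settles them for
  \<open>pointed_kappa\<close>.\<close>

lemma maps_homs_pointed_sigma: "maps_homs pointed_emodels pointed_smodels pointed_sigma"
  unfolding maps_homs_def
proof (intro conjI ballI)
  fix Mw
  assume "Mw \<in> Ob pointed_emodels"
  then show "on_ob pointed_sigma Mw \<in> Ob pointed_smodels"
    by (simp add: pointed_simplicial_models_simps pointed_proper_epistemic_models_simps Ob_smodels Ob_emodels
        emod.smod_sigma[of A AP] emod.facet_sigma[of A AP])
next
  fix Mw Nu h
  assume *: "Mw \<in> Ob pointed_emodels" "Nu \<in> Ob pointed_emodels" "h \<in> Hom pointed_emodels Mw Nu"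
  then have h: "epistemic_morphism AP (fst Mw) (fst Nu) h" "snd Nu \<in> h (snd Mw)"
    and w: "snd Mw \<in> worlds (fst Mw)" "snd Nu \<in> worlds (fst Nu)"
    by (auto simp: pointed_proper_epistemic_models_simps)
  interpret frame_map A AP "fst Mw" "fst Nu" h
    using * h by (intro frame_mapI epistemic_morphism_frame)
      (auto simp: pointed_proper_epistemic_models_simps Ob_emodels)
  show "on_mor pointed_sigma Mw Nu h \<in> Hom pointed_smodels (on_ob pointed_sigma Mw) (on_ob pointed_sigma Nu)"
    using simplicial_morphism_sigma[OF h(1)] sigma_mor_world_facet[OF w] h(2)
    by (simp add: pointed_simplicial_models_simps)
qed

lemma is_iso_unit:
  assumes "smod A AP C"
  shows "is_iso smodels C (sigma_ob (kappa_ob C)) (simplicial_unit C)"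
proof -
  interpret smod A AP C by fact
  show ?thesis
    unfolding is_iso_def simplicial_models_simps mem_Collect_eq
    using unit_morphism unit_inverse_morphism unit_inverse_comp by blast
qed

text \<open>The unit sends \<open>X\<close> onto the distinguished facet of the double image, so its
  inverse respects the points as well.\<close>

lemma is_iso_pointed_unit:
  assumes "smod A AP C" "X \<in> facets C"
  shows "is_iso pointed_smodels (C, X) (sigma_ob (kappa_ob C), world_facet (kappa_ob C) (vset X)) (simplicial_unit C)"
proof -
  interpret smod A AP C by fact
  have "X \<subseteq> verts C"
    using facet_verts[OF assms(2)] by blast
  then have "unit_inverse ` world_facet (kappa_ob C) (vset X) \<subseteq> X"
    using unit_facet[OF assms(2)] unit_inverse_image by (metis order_refl)
  then show ?thesis
    unfolding is_iso_def pointed_simplicial_models_simps simplicial_models_simps fst_conv snd_conv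
      mem_Collect_eq
    using unit_morphism unit_inverse_morphism unit_inverse_comp unit_facet[OF assms(2)] by blast
qed

lemma is_iso_counit:
  assumes "emod A AP M"
  shows "is_iso emodels (kappa_ob (sigma_ob M)) M (epistemic_counit M)"
proof -
  interpret emod A AP M by fact
  show ?thesis
    unfolding is_iso_def proper_epistemic_models_simps mem_Collect_eq
    using counit_morphism counit_inverse_morphism counit_inverse_comp by blast
qed

lemma is_iso_pointed_counit:
  assumes "emod A AP M" "w \<in> worlds M"
  shows "is_iso pointed_emodels (kappa_ob (sigma_ob M), vset (world_facet M w)) (M, w) (epistemic_counit M)"
proof -
  interpret emod A AP M by fact
  have "w \<in> epistemic_counit M (vset (world_facet M w))" "vset (world_facet M w) \<in> counit_inverse w"
    using counit_world[OF assms(2)] counit_inverse_world[OF assms(2)] by auto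
  then show ?thesis
    unfolding is_iso_def pointed_proper_epistemic_models_simps proper_epistemic_models_simps
      fst_conv snd_conv mem_Collect_eq
    using counit_morphism counit_inverse_morphism counit_inverse_comp by blast
qed

lemma equivalence_models: "equivalence_of_categories (generated_cat smodels) (generated_cat emodels) kappa sigma"
proof (rule equivalence_generated[OF lies_over_chromatic category_chromatic_models
      lies_over_frames category_proper_frames is_functor_kappa _ maps_homs_kappa
      is_functor_sigma _ maps_homs_sigma])
  show "is_iso smodels C (on_ob sigma (on_ob kappa C)) (simplicial_unit C)" if "C \<in> Ob smodels" for C
    using that is_iso_unit by (simp add: Ob_smodels)
  show "is_iso emodels (on_ob kappa (on_ob sigma M)) M (epistemic_counit M)" if "M \<in> Ob emodels" for M
    using that is_iso_counit by (simp add: Ob_emodels)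
qed (simp_all add: functor_over_def chromatic_models_simps proper_frames_simps
    simplicial_models_simps proper_epistemic_models_simps Ob_smodels Ob_emodels
    chromatic.unit_natural[OF chromaticI[of A AP]] frame_map.counit_natural[OF frame_mapI[of A AP]])

text \<open>Functor laws and naturality are those of the unpointed ambient categories via
  \<open>fst\<close>; points enter only through the generators and the isomorphisms.\<close>

lemma equivalence_pointed_models:
  "equivalence_of_categories (generated_cat pointed_smodels) (generated_cat pointed_emodels) pointed_kappa pointed_sigma"
proof (rule equivalence_generated[OF lies_over_chromatic_pointed category_chromatic_models
      lies_over_frames_pointed category_proper_frames is_functor_kappa _ maps_homs_pointed_kappa
      is_functor_sigma _ maps_homs_pointed_sigma])
  show "is_iso pointed_smodels CX (on_ob pointed_sigma (on_ob pointed_kappa CX)) (simplicial_unit (fst CX))"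
    if "CX \<in> Ob pointed_smodels" for CX
    using that is_iso_pointed_unit[of "fst CX" "snd CX"]
    by (simp add: Ob_smodels pointed_simplicial_models_simps)
  show "is_iso pointed_emodels (on_ob pointed_kappa (on_ob pointed_sigma Mw)) Mw (epistemic_counit (fst Mw))"
    if "Mw \<in> Ob pointed_emodels" for Mw
    using that is_iso_pointed_counit[of "fst Mw" "snd Mw"]
    by (simp add: Ob_emodels pointed_proper_epistemic_models_simps)
qed (simp_all add: functor_over_def chromatic_models_simps proper_frames_simps
    simplicial_models_simps proper_epistemic_models_simps Ob_smodels Ob_emodels
    chromatic.unit_natural[OF chromaticI[of A AP]] frame_map.counit_natural[OF frame_mapI[of A AP]])

end

theorem theorem29:
  fixes A :: "'a set" and AP :: "'a \<Rightarrow> 'p set"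
  assumes "finite A" and "A \<noteq> {}" and "disjoint_family_on AP A"
  shows
    "(let SM = (simplicial_models A AP
            :: (('a, 'p, ('a, 'b, 'k::infinite) univ) smodel,
                ('a, 'b, 'k) univ \<Rightarrow> ('a, 'b, 'k) univ) cat);
          EM = (proper_epistemic_models A AP
            :: (('a, 'p, ('a, 'b, 'k) univ) emodel,
                ('a, 'b, 'k) univ \<Rightarrow> ('a, 'b, 'k) univ set) cat)
      in maps_homs SM EM kappa \<and> maps_homs EM SM sigma \<and>
         equivalence_of_categories (generated_cat SM) (generated_cat EM) kappa sigma) \<and>
     (let SM = (pointed_simplicial_models A AP
            :: (('a, 'p, ('a, 'b, 'k) univ) smodel \<times> ('a, 'b, 'k) univ set,
                ('a, 'b, 'k) univ \<Rightarrow> ('a, 'b, 'k) univ) cat);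
          EM = (pointed_proper_epistemic_models A AP
            :: (('a, 'p, ('a, 'b, 'k) univ) emodel \<times> ('a, 'b, 'k) univ,
                ('a, 'b, 'k) univ \<Rightarrow> ('a, 'b, 'k) univ set) cat)
      in maps_homs SM EM pointed_kappa \<and> maps_homs EM SM pointed_sigma \<and>
         equivalence_of_categories (generated_cat SM) (generated_cat EM)
           pointed_kappa pointed_sigma)"
  unfolding Let_def
  by (intro conjI maps_homs_kappa maps_homs_sigma equivalence_models maps_homs_pointed_kappa
      maps_homs_pointed_sigma equivalence_pointed_models assms(1))

end
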